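(* Let $u,v\in S_\infty$ and suppose $v^{-1}\mu_v=s_{i_1}\cdots s_{i_m}$ with $\ell(us_{i_j})>\ell(u)$ for all $1\le j\le m$. Then $$\mathfrak{S}_u(x;y)\,\mathfrak{S}_v(x;z)=\sum_{w\in S_\infty}e_{uv}^w(y;z)\,\mathfrak{S}_w(x;y).$$
   Context: **Permutations.** $\mathbb{N}=\{1,2,3,\dots\}$. $S_\infty$ is the group of bijections $\mathbb{N}\to\mathbb{N}$ fixing all but finitely many elements, with product $(uv)(i)=u(v(i))$ and identity $1$; $S_n\subset S_\infty$ is the subgroup of $u$ with $u(i)=i$ for $i>n$. $s_i$ ($i\ge 1$) is the transposition of $i$ and $i+1$; $t_{ab}=t_{ba}$ ($a\ne b$) is the transposition of $a$ and $b$. $\ell(u)$ is the number of pairs $i<j$ with $u(i)>u(j)$. **Double Schubert polynomials.** Work in the polynomial ring $\mathbb{Z}[x,y,z]$ in the variables $x_i,y_i,z_i$ ($i\in\mathbb{N}$). $s_i$ acts by the ring automorphism exchanging $x_i$ and $x_{i+1}$ and fixing all other variables. Put $\partial^{s_i}(P)=\frac{P-s_i(P)}{x_i-x_{i+1}}$, and $\partial^u=\partial^{s_{i_1}}\cdots\partial^{s_{i_m}}$ for any reduced word $u=s_{i_1}\cdots s_{i_m}$, $m=\ell(u)$ (independent of the choice). Let $w_0(n)\in S_{n+1}$ be given by $w_0(n)(i)=n+2-i$ for $i\le n+1$, and $\mathfrak{S}_{w_0(n)}(x;y)=\prod_{i,j\ge 1,\ i+j\le n+1}(x_i-y_j)$.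 For $u\in S_{n+1}$, $\mathfrak{S}_u(x;y)=\partial^{u^{-1}w_0(n)}(\mathfrak{S}_{w_0(n)}(x;y))$ (independent of $n$). $\mathfrak{S}_v(x;z)$ is obtained by replacing each $y_j$ by $z_j$. **Code, dominant approximation.** The code of $v\in S_\infty$ is the sequence $\mathfrak{c}_i(v)=\#\{j>i\mid v(i)>v(j)\}$, $i\ge1$. $v$ is dominant if $\mathfrak{c}(v)$ is a partition (weakly decreasing). The dominant approximation $\mu_v$ is defined recursively: if $v$ is dominant, $\mu_v=v$; otherwise let $i$ be the maximal index with $\mathfrak{c}_i(v)<\mathfrak{c}_{i+1}(v)$ and put $\mu_v=\mu_{vs_i}$ (this terminates). $\lambda(v)$ is the partition conjugate to the code of $\mu_v$: $\lambda_i(v)=\#\{j\mid \mathfrak{c}_j(\mu_v)\ge i\}$. **The relation $\xrightarrow{k}$ and weights.** For $u,u'\in S_\infty$ and a positive integer $k$, write $u\xrightarrow{k}u'$ if there exist $p$ with $0\le p\le k$ and transpositions $t_{a_1b_1},\dots,t_{a_pb_p}$ such that (1) $a_i\le k<b_i$ for all $i$; (2) $a_i\ne a_j$ for $i\neq j$; (3) $\ell(ut_{a_1b_1}\cdots t_{a_ib_i})=\ell(u)+i$ for all $i$; (4) $u'=ut_{a_1b_1}\cdots t_{a_pb_p}$. If $u\xrightarrow{k}w$, let $P_k(u,w)=\{u(i)\mid i\le k,\ u(i)=w(i)\}$ and $\mathrm{weight}_{u,k}^w(y;z_j)=\prod_{i\in P_k(u,w)}(y_i-z_j)$ (empty product $=1$).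 For a partition $\lambda=(\lambda_1,\dots,\lambda_m)$ of length $m$, $\mathrm{Path}_\lambda(u,w)$ is the set of sequences $(u_0,\dots,u_m)$ in $S_\infty$ with $u=u_0\xrightarrow{\lambda_1}u_1\xrightarrow{\lambda_2}\cdots\xrightarrow{\lambda_m}u_m=w$, and for such a path $P$, $\mathrm{weight}_{P,\lambda}(y;z)=\prod_{i=1}^m\mathrm{weight}_{u_{i-1},\lambda_i}^{u_i}(y;z_i)$. **The coefficients.** $d_{u,\lambda}^w(y;z)=\sum_{P\in\mathrm{Path}_\lambda(u,w)}\mathrm{weight}_{P,\lambda}(y;z)$. For $u,v,w\in S_\infty$: if $\ell(wv^{-1}\mu_v)=\ell(w)+\ell(v^{-1}\mu_v)$ then $e_{uv}^w(y;z)=d_{u,\lambda(v)}^{wv^{-1}\mu_v}(y;z)$; otherwise $e_{uv}^w(y;z)=0$. *)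

theory Defs
  imports
    "HOL-Library.Poly_Mapping"
    "HOL-Combinatorics.Permutations"
begin

section \<open>Finitely supported permutations of the positive integers\<close>

text \<open>
  A permutation of \<open>{1, 2, ...}\<close> is a function on \<^typ>\<open>nat\<close> fixing \<open>0\<close>.
  The product is \<^const>\<open>comp\<close>.
\<close>

definition S_infty :: "(nat \<Rightarrow> nat) set" where
  "S_infty = {u. \<exists>n. u permutes {1..n}}"

definition adj :: "nat \<Rightarrow> nat \<Rightarrow> nat" where
  "adj i = transpose i (i + 1)"

definition len :: "(nat \<Rightarrow> nat) \<Rightarrow> nat" where
  "len u = card {(i, j). 1 \<le> i \<and> i < j \<and> u i > u j}"

definition word_prod :: "nat list \<Rightarrow> nat \<Rightarrow> nat" where
  "word_prod ws = foldr (\<lambda>i g. adj i \<circ> g) ws id"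

definition reduced_word :: "nat list \<Rightarrow> (nat \<Rightarrow> nat) \<Rightarrow> bool" where
  "reduced_word ws u \<longleftrightarrow> (\<forall>i\<in>set ws. 1 \<le> i) \<and> word_prod ws = u \<and> length ws = len u"


section \<open>The polynomial ring\<close>

datatype indet = x_ind nat | y_ind nat | z_ind nat

text \<open>
  Only the variables with positive index are used. A polynomial maps exponent vectors
  to integer coefficients; multiplication is the convolution product of
  \<^theory>\<open>HOL-Library.Poly_Mapping\<close>.
\<close>

type_synonym mpoly = "(indet \<Rightarrow>\<^sub>0 nat) \<Rightarrow>\<^sub>0 int"

definition Var :: "indet \<Rightarrow> mpoly" where
  "Var a = Poly_Mapping.single (Poly_Mapping.single a 1) 1"

text \<open>The ring endomorphism sending each variable \<open>a\<close> to \<open>f a\<close>.\<close>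

definition subst_poly :: "(indet \<Rightarrow> mpoly) \<Rightarrow> mpoly \<Rightarrow> mpoly" where
  "subst_poly f P =
     (\<Sum>m\<in>Poly_Mapping.keys P. of_int (Poly_Mapping.lookup P m) *
        (\<Prod>a\<in>Poly_Mapping.keys m. f a ^ Poly_Mapping.lookup m a))"

fun swap_indet :: "nat \<Rightarrow> indet \<Rightarrow> indet" where
  "swap_indet i (x_ind j) = x_ind (adj i j)"
| "swap_indet i (y_ind j) = y_ind j"
| "swap_indet i (z_ind j) = z_ind j"

definition act :: "nat \<Rightarrow> mpoly \<Rightarrow> mpoly" where
  "act i = subst_poly (\<lambda>a. Var (swap_indet i a))"

fun y_to_z_indet :: "indet \<Rightarrow> indet" where
  "y_to_z_indet (x_ind j) = x_ind j"
| "y_to_z_indet (y_ind j) = z_ind j"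
| "y_to_z_indet (z_ind j) = z_ind j"


section \<open>Double Schubert polynomials\<close>

text \<open>The quotient exists and is unique, the polynomial ring being an integral domain.\<close>

definition divdiff :: "nat \<Rightarrow> mpoly \<Rightarrow> mpoly" where
  "divdiff i P = (THE Q. (Var (x_ind i) - Var (x_ind (i + 1))) * Q = P - act i P)"

definition divdiff_word :: "nat list \<Rightarrow> mpoly \<Rightarrow> mpoly" where
  "divdiff_word ws = foldr (\<lambda>i F. divdiff i \<circ> F) ws id"

text \<open>Any reduced word gives the same operator.\<close>

definition divdiff_perm :: "(nat \<Rightarrow> nat) \<Rightarrow> mpoly \<Rightarrow> mpoly" where
  "divdiff_perm u = divdiff_word (SOME ws. reduced_word ws u)"

definition w0 :: "nat \<Rightarrow> nat \<Rightarrow> nat" where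
  "w0 n i = (if 1 \<le> i \<and> i \<le> n + 1 then n + 2 - i else i)"

definition schubert_w0 :: "nat \<Rightarrow> mpoly" where
  "schubert_w0 n =
     (\<Prod>(i, j)\<in>{(i, j). 1 \<le> i \<and> 1 \<le> j \<and> i + j \<le> n + 1}. Var (x_ind i) - Var (y_ind j))"

text \<open>
  Any \<open>n\<close> such that \<open>u\<close> lies in the symmetric group on \<open>{1..n + 1}\<close> gives the same
  polynomial; the least one is taken.
\<close>

definition schubert_xy :: "(nat \<Rightarrow> nat) \<Rightarrow> mpoly" where
  "schubert_xy u =
     (let n = (LEAST n. u permutes {1..n + 1})
      in divdiff_perm (inv u \<circ> w0 n) (schubert_w0 n))"

definition schubert_xz :: "(nat \<Rightarrow> nat) \<Rightarrow> mpoly" where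
  "schubert_xz v = subst_poly (\<lambda>a. Var (y_to_z_indet a)) (schubert_xy v)"


section \<open>Code and dominant approximation\<close>

definition lehmer_code :: "(nat \<Rightarrow> nat) \<Rightarrow> nat \<Rightarrow> nat" where
  "lehmer_code v i = card {j. i < j \<and> v i > v j}"

definition dominant :: "(nat \<Rightarrow> nat) \<Rightarrow> bool" where
  "dominant v \<longleftrightarrow> (\<forall>i\<ge>1. lehmer_code v (i + 1) \<le> lehmer_code v i)"

definition last_ascent :: "(nat \<Rightarrow> nat) \<Rightarrow> nat" where
  "last_ascent v = Max {i. 1 \<le> i \<and> lehmer_code v i < lehmer_code v (i + 1)}"

lemma permutes_lehmer_code_0:
  assumes "v permutes {1..n}" "n \<le> i"
  shows "lehmer_code v i = 0"
proof -
  have "\<not> (i < j \<and> v j < v i)" for j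
  proof
    assume ij: "i < j \<and> v j < v i"
    then have "v j = j" using assms permutes_not_in[OF assms(1), of j] by simp
    moreover have "v i \<le> i"
    proof (cases "i \<in> {1..n}")
      case True
      then have "v i \<in> {1..n}" using permutes_in_image[OF assms(1), of i] by simp
      then show ?thesis using assms(2) by simp
    next
      case False
      then show ?thesis using permutes_not_in[OF assms(1)] by simp
    qed
    ultimately show False using ij by simp
  qed
  then have "{j. i < j \<and> v i > v j} = {}" by blast
  then show ?thesis unfolding lehmer_code_def by (simp only: card.empty)
qed

lemma code_le_of_descent:
  assumes "v permutes {1..n}" "v (Suc i) < v i"
  shows "lehmer_code v (Suc i) \<le> lehmer_code v i"
  unfolding lehmer_code_def
proof (rule card_mono)
  have "{j. i < j \<and> v j < v i} \<subseteq> v -` {..<v i}" by auto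
  moreover have "finite (v -` {..<v i})"
    using assms(1) by (intro finite_vimageI) (auto simp: permutes_inj)
  ultimately show "finite {j. i < j \<and> v j < v i}" by (rule finite_subset)
  show "{j. Suc i < j \<and> v j < v (Suc i)} \<subseteq> {j. i < j \<and> v j < v i}"
    using assms(2) by auto
qed

lemma last_ascent_props:
  assumes "v permutes {1..n}" "\<not> dominant v"
  shows "1 \<le> last_ascent v" "last_ascent v + 1 \<le> n"
    "lehmer_code v (last_ascent v) < lehmer_code v (last_ascent v + 1)"
    "v (last_ascent v) < v (last_ascent v + 1)"
proof -
  let ?A = "{i. 1 \<le> i \<and> lehmer_code v i < lehmer_code v (i + 1)}"
  have bound: "i + 1 \<le> n" if "i \<in> ?A" for i
    using that permutes_lehmer_code_0[OF assms(1), of "i + 1"] by (cases "i + 1 \<le> n") auto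
  then have "?A \<subseteq> {..n}" by fastforce
  then have "finite ?A" by (rule finite_subset) simp
  moreover have "?A \<noteq> {}" using assms(2) unfolding dominant_def by (auto simp: not_le Suc_le_eq)
  ultimately have mem: "last_ascent v \<in> ?A" unfolding last_ascent_def by (rule Max_in)
  then show "1 \<le> last_ascent v" "last_ascent v + 1 \<le> n"
    and lt: "lehmer_code v (last_ascent v) < lehmer_code v (last_ascent v + 1)" using bound by auto
  have "v (last_ascent v) \<noteq> v (last_ascent v + 1)"
    by (simp add: inj_eq[OF permutes_inj[OF assms(1)]])
  moreover have "\<not> v (last_ascent v + 1) < v (last_ascent v)"
    using code_le_of_descent[OF assms(1), of "last_ascent v"] lt by auto
  ultimately show "v (last_ascent v) < v (last_ascent v + 1)" by simp
qed

text \<open>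
  Each step of the recursion removes a pair of positions on which \<open>v\<close> is increasing. The
  membership test only serves termination outside \<^const>\<open>S_infty\<close>.
\<close>

definition noninversions :: "(nat \<Rightarrow> nat) \<Rightarrow> nat" where
  "noninversions v =
     card {(a, b). 1 \<le> a \<and> a < b \<and> b \<le> (LEAST n. v permutes {1..n}) \<and> v a < v b}"

lemma noninversions_decrease:
  assumes "v \<in> S_infty" "\<not> dominant v"
  shows "noninversions (v \<circ> adj (last_ascent v)) < noninversions v"
proof -
  define i where "i = last_ascent v"
  define n where "n = (LEAST n. v permutes {1..n})"
  define v' where "v' = v \<circ> adj i"
  define n' where "n' = (LEAST n. v' permutes {1..n})"
  obtain m where "v permutes {1..m}" using assms(1) unfolding S_infty_def by blast
  then have n: "v permutes {1..n}" unfolding n_def by (rule LeastI)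
  note i = last_ascent_props[OF n assms(2), folded i_def]
  have "adj i permutes {1..n}"
    unfolding adj_def using i by (intro permutes_swap_id) auto
  then have "v' permutes {1..n}"
    unfolding v'_def using n by (intro permutes_compose)
  then have "n' \<le> n" unfolding n'_def by (rule Least_le)
  define A where "A = {(a, b). 1 \<le> a \<and> a < b \<and> b \<le> n \<and> v a < v b}"
  define B where "B = {(a, b). 1 \<le> a \<and> a < b \<and> b \<le> n' \<and> v' a < v' b}"
  have finA: "finite A"
    by (rule finite_subset[of _ "{..n} \<times> {..n}"]) (auto simp: A_def)
  have v': "v' a = v (adj i a)" for a by (simp add: v'_def)
  have sub: "(\<lambda>(a, b). (adj i a, adj i b)) ` B \<subseteq> A - {(i, i + 1)}"
  proof clarify
    fix a b assume "(a, b) \<in> B"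
    then have ab: "1 \<le> a" "a < b" "b \<le> n" "v (adj i a) < v (adj i b)"
      using \<open>n' \<le> n\<close> by (auto simp: B_def v')
    have ne: "\<not> (a = i \<and> b = i + 1)"
      using ab(4) i(4) by (auto simp: adj_def)
    then have "1 \<le> adj i a" "adj i a < adj i b" "adj i b \<le> n"
      using ab i unfolding adj_def transpose_def by (auto split: if_splits)
    moreover have "\<not> (adj i a = i \<and> adj i b = i + 1)"
      using ab(2) unfolding adj_def transpose_def by (auto split: if_splits)
    ultimately show "(adj i a, adj i b) \<in> A - {(i, i + 1)}"
      using ab(4) by (auto simp: A_def)
  qed
  have inj: "inj_on (\<lambda>(a, b). (adj i a, adj i b)) B"
    by (auto simp: inj_on_def adj_def dest: transpose_eq_imp_eq)
  have "card B \<le> card (A - {(i, i + 1)})"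
    using card_inj_on_le[OF inj sub] finA by simp
  also have "\<dots> < card A"
  proof (rule psubset_card_mono[OF finA])
    have "(i, i + 1) \<in> A" using i by (auto simp: A_def)
    then show "A - {(i, i + 1)} \<subset> A" by blast
  qed
  finally show ?thesis
    unfolding noninversions_def A_def B_def n_def n'_def v'_def i_def .
qed

function dom_approx :: "(nat \<Rightarrow> nat) \<Rightarrow> nat \<Rightarrow> nat" where
  "dom_approx v =
     (if v \<in> S_infty \<and> \<not> dominant v then dom_approx (v \<circ> adj (last_ascent v)) else v)"
  by pat_completeness auto
termination
  by (relation "measure noninversions") (simp_all add: noninversions_decrease)

declare dom_approx.simps [simp del]

definition lambda_part :: "(nat \<Rightarrow> nat) \<Rightarrow> nat \<Rightarrow> nat" where
  "lambda_part v i = card {j. 1 \<le> j \<and> i \<le> lehmer_code (dom_approx v) j}"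

text \<open>The list of the nonzero parts \<open>\<lambda>\<^sub>1(v), \<lambda>\<^sub>2(v), ...\<close>.\<close>

definition conj_partition :: "(nat \<Rightarrow> nat) \<Rightarrow> nat list" where
  "conj_partition v = map (lambda_part v) [1..<card {i. 1 \<le> i \<and> lambda_part v i \<noteq> 0} + 1]"


section \<open>Paths and weights\<close>

definition transp_prod :: "(nat \<times> nat) list \<Rightarrow> nat \<Rightarrow> nat" where
  "transp_prod ts = foldr (\<lambda>(a, b) g. transpose a b \<circ> g) ts id"

definition arrow :: "nat \<Rightarrow> (nat \<Rightarrow> nat) \<Rightarrow> (nat \<Rightarrow> nat) \<Rightarrow> bool" where
  "arrow k u u' \<longleftrightarrow>
     (\<exists>ts. length ts \<le> k \<and>
        (\<forall>(a, b)\<in>set ts. 1 \<le> a \<and> a \<le> k \<and> k < b) \<and>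
        distinct (map fst ts) \<and>
        (\<forall>i\<in>{1..length ts}. len (u \<circ> transp_prod (take i ts)) = len u + i) \<and>
        u' = u \<circ> transp_prod ts)"

definition fixed_values :: "nat \<Rightarrow> (nat \<Rightarrow> nat) \<Rightarrow> (nat \<Rightarrow> nat) \<Rightarrow> nat set" where
  "fixed_values k u w = {u i | i. 1 \<le> i \<and> i \<le> k \<and> u i = w i}"

definition weight :: "(nat \<Rightarrow> nat) \<Rightarrow> nat \<Rightarrow> (nat \<Rightarrow> nat) \<Rightarrow> nat \<Rightarrow> mpoly" where
  "weight u k w j = (\<Prod>i\<in>fixed_values k u w. Var (y_ind i) - Var (z_ind j))"

definition paths ::
    "nat list \<Rightarrow> (nat \<Rightarrow> nat) \<Rightarrow> (nat \<Rightarrow> nat) \<Rightarrow> (nat \<Rightarrow> nat) list set" where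
  "paths lam u w =
     {p. length p = length lam + 1 \<and> set p \<subseteq> S_infty \<and> p ! 0 = u \<and> p ! length lam = w \<and>
         (\<forall>i<length lam. arrow (lam ! i) (p ! i) (p ! (i + 1)))}"

text \<open>List positions start at \<open>0\<close>, hence the index shift in the variable \<open>z\<close>.\<close>

definition path_weight :: "nat list \<Rightarrow> (nat \<Rightarrow> nat) list \<Rightarrow> mpoly" where
  "path_weight lam p = (\<Prod>i<length lam. weight (p ! i) (lam ! i) (p ! (i + 1)) (i + 1))"

definition d_coeff :: "(nat \<Rightarrow> nat) \<Rightarrow> nat list \<Rightarrow> (nat \<Rightarrow> nat) \<Rightarrow> mpoly" where
  "d_coeff u lam w = (\<Sum>p\<in>paths lam u w. path_weight lam p)"

definition e_coeff :: "(nat \<Rightarrow> nat) \<Rightarrow> (nat \<Rightarrow> nat) \<Rightarrow> (nat \<Rightarrow> nat) \<Rightarrow> mpoly" where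
  "e_coeff u v w =
     (if len (w \<circ> inv v \<circ> dom_approx v) = len w + len (inv v \<circ> dom_approx v)
      then d_coeff u (conj_partition v) (w \<circ> inv v \<circ> dom_approx v)
      else 0)"

end

theory Submission
  imports Defs
begin

text \<open>
  Write \<open>v\<^bsup>-1\<^esup>\<mu> = s\<^sub>i\<^sub>1 \<cdots> s\<^sub>i\<^sub>m\<close> as a reduced word, where \<open>\<mu>\<close> is the dominant approximation of \<open>v\<close>. Its
  letters are ascents of \<open>u\<close>, so the Schubert polynomial of \<open>u\<close> is symmetric under them and passes
  through the corresponding divided differences, which turn the polynomial of \<open>\<mu>\<close> into that of \<open>v\<close>.
  This reduces the theorem to \<open>v = \<mu>\<close> dominant, where the polynomial of \<open>\<mu>\<close> is the product over its
  columns of \<open>(x\<^sub>1 - z\<^sub>j) \<cdots> (x\<^sub>k - z\<^sub>j)\<close> with \<open>k = \<lambda>\<^sub>j\<close>, and hence to a Pieri formula for one such factor.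

  The Pieri formula follows from Monk's formula without any cancellation if \<open>u\<close> decreases on \<open>{1..k}\<close>.
  The general case is obtained from this one by the divided differences \<open>\<partial>\<^sub>i\<close> with \<open>i < k\<close>: they commute
  with the symmetric factor, and ascents at \<open>i\<close> persist along the chains that define the relation
  \<^const>\<open>arrow\<close>. Monk's formula and the product formula for dominant permutations are likewise
  proved by descending from the longest permutations.
\<close>

section \<open>The polynomial ring\<close>

subsection \<open>Substitution homomorphisms\<close>

text \<open>The hypothesis on \<open>u\<close> concerns one word for \<open>v^-1 mu_v\<close>,
  possibly not reduced, while only reduced words give the divided difference of a permutation. The
  proof therefore takes the word produced by the recursion for \<open>dom_approx\<close>, which is
  reduced since every step adds one to the length, and shows that its letters occur in the given
  word: a word without the letter \<open>i\<close> preserves \<open>{1..i}\<close>, a reduced word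
  containing \<open>i\<close> does not.

  The obstacle in the Pieri formula is a sign: in Monk's formula for a single variable
  \<open>x_a\<close>, transpositions of \<open>a\<close> with a position to its left enter
  negatively, and in general such terms have to cancel in the product over \<open>{1..k}\<close>. If
  \<open>u\<close> decreases on \<open>{1..k}\<close>, the covers met at position \<open>a\<close>
  only involve positions beyond \<open>k\<close>, so they never appear.

  The case distinction in \<open>e_coeff\<close> comes from applying the divided differences for
  \<open>v^-1 mu_v\<close> to the expansion for \<open>mu_v\<close>: a Schubert polynomial survives
  exactly if every letter lowers the length. The coefficients contain only \<open>y\<close> and
  \<open>z\<close>, so they are constants for these operators.\<close>

text \<open>A linear order on the variables makes the polynomial ring an instance of \<^class>\<open>idom\<close>.\<close>

fun indet_index :: "indet \<Rightarrow> nat" where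
  "indet_index (x_ind j) = 3 * j"
| "indet_index (y_ind j) = 3 * j + 1"
| "indet_index (z_ind j) = 3 * j + 2"

lemma indet_index_eq_iff: "indet_index a = indet_index b \<longleftrightarrow> a = b"
  by (cases a; cases b) (simp_all, presburger+)

instantiation indet :: linorder
begin

definition less_eq_indet :: "indet \<Rightarrow> indet \<Rightarrow> bool" where
  "less_eq_indet a b \<longleftrightarrow> indet_index a \<le> indet_index b"

definition less_indet :: "indet \<Rightarrow> indet \<Rightarrow> bool" where
  "less_indet a b \<longleftrightarrow> indet_index a < indet_index b"

instance
  by standard (auto simp: less_eq_indet_def less_indet_def indet_index_eq_iff)

end

lemma poly_mapping_induct_add [case_names single add]:
  fixes p :: "'a \<Rightarrow>\<^sub>0 'b::comm_monoid_add"
  assumes "\<And>k v. R (Poly_Mapping.single k v)"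
    and "\<And>p q. R p \<Longrightarrow> R q \<Longrightarrow> R (p + q)"
  shows "R p"
proof -
  have R0: "R 0" using assms(1)[of undefined 0] by simp
  have "p = (\<Sum>k\<in>Poly_Mapping.keys p. Poly_Mapping.single k (Poly_Mapping.lookup p k))"
    by (rule poly_mapping_eqI)
      (auto simp: lookup_sum lookup_single when_def sum.delta in_keys_iff)
  moreover have "R (\<Sum>k\<in>A. Poly_Mapping.single k (Poly_Mapping.lookup p k))" if "finite A" for A
    using that by induction (auto simp: R0 assms)
  ultimately show ?thesis by (metis finite_keys)
qed

definition subst_monom :: "(indet \<Rightarrow> mpoly) \<Rightarrow> (indet \<Rightarrow>\<^sub>0 nat) \<Rightarrow> mpoly" where
  "subst_monom f m = (\<Prod>a\<in>Poly_Mapping.keys m. f a ^ Poly_Mapping.lookup m a)"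

text \<open>A common larger index set makes two arguments with different supports comparable;
  \<open>subst_poly_superset\<close> does the same one level up.\<close>

lemma subst_monom_superset:
  "finite A \<Longrightarrow> Poly_Mapping.keys m \<subseteq> A \<Longrightarrow>
    subst_monom f m = (\<Prod>a\<in>A. f a ^ Poly_Mapping.lookup m a)"
  unfolding subst_monom_def by (rule prod.mono_neutral_left) (auto simp: in_keys_iff)

lemma subst_monom_add: "subst_monom f (m + n) = subst_monom f m * subst_monom f n"
proof -
  let ?A = "Poly_Mapping.keys m \<union> Poly_Mapping.keys n"
  have "Poly_Mapping.keys (m + n) \<subseteq> ?A" by (rule keys_add)
  then show ?thesis
    by (simp add: subst_monom_superset[of ?A] lookup_add power_add prod.distrib)
qed

lemma subst_poly_superset:
  "finite A \<Longrightarrow> Poly_Mapping.keys P \<subseteq> A \<Longrightarrow>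
    subst_poly f P = (\<Sum>m\<in>A. of_int (Poly_Mapping.lookup P m) * subst_monom f m)"
  unfolding subst_poly_def subst_monom_def[symmetric]
  by (rule sum.mono_neutral_left) (auto simp: in_keys_iff)

lemma subst_poly_add: "subst_poly f (P + Q) = subst_poly f P + subst_poly f Q"
proof -
  let ?A = "Poly_Mapping.keys P \<union> Poly_Mapping.keys Q"
  have "Poly_Mapping.keys (P + Q) \<subseteq> ?A" by (rule keys_add)
  then show ?thesis
    by (simp add: subst_poly_superset[of ?A] lookup_add algebra_simps sum.distrib)
qed

lemma subst_poly_single: "subst_poly f (Poly_Mapping.single m c) = of_int c * subst_monom f m"
  by (simp add: subst_poly_superset[of "{m}"] split: if_splits)

lemma subst_poly_mult: "subst_poly f (P * Q) = subst_poly f P * subst_poly f Q"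
proof (induction P rule: poly_mapping_induct_add)
  case (single m c)
  show ?case
    by (induction Q rule: poly_mapping_induct_add)
      (simp_all add: mult_single subst_poly_single subst_monom_add subst_poly_add algebra_simps)
qed (simp add: subst_poly_add algebra_simps)

lemma subst_poly_of_int [simp]: "subst_poly f (of_int c) = of_int c"
proof -
  have "(of_int c :: mpoly) = Poly_Mapping.single 0 c"
    by (simp flip: single_of_int)
  then show ?thesis by (simp only: subst_poly_single) (simp add: subst_monom_def)
qed

lemma subst_poly_0 [simp]: "subst_poly f 0 = 0"
  using subst_poly_of_int[of f 0] by simp

lemma subst_poly_1 [simp]: "subst_poly f 1 = 1"
  using subst_poly_of_int[of f 1] by simp

lemma subst_poly_minus: "subst_poly f (P - Q) = subst_poly f P - subst_poly f Q"
  using subst_poly_add[of f "P - Q" Q] by simp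

lemma subst_poly_sum: "subst_poly f (sum g A) = (\<Sum>a\<in>A. subst_poly f (g a))"
  by (induction A rule: infinite_finite_induct) (simp_all add: subst_poly_add)

lemma subst_poly_prod: "subst_poly f (prod g A) = (\<Prod>a\<in>A. subst_poly f (g a))"
  by (induction A rule: infinite_finite_induct) (simp_all add: subst_poly_mult)

lemma subst_poly_Var [simp]: "subst_poly f (Var a) = f a"
  by (simp add: Var_def subst_poly_single subst_monom_def)

lemmas subst_poly_hom =
  subst_poly_add subst_poly_minus subst_poly_mult subst_poly_sum subst_poly_prod

text \<open>Identities between compositions of the ring homomorphisms \<open>act i\<close> are
  checked on variables in this way.\<close>

lemma mpoly_induct [case_names const Var add mult]:
  assumes const: "\<And>c. R (of_int c)" and Var: "\<And>a. R (Var a)"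
    and add: "\<And>P Q. R P \<Longrightarrow> R Q \<Longrightarrow> R (P + Q)" and mult: "\<And>P Q. R P \<Longrightarrow> R Q \<Longrightarrow> R (P * Q)"
  shows "R P"
proof (induction P rule: poly_mapping_induct_add)
  case (single m c)
  show ?case
  proof (induction m arbitrary: c rule: poly_mapping_induct_add)
    case (single a k)
    have "R (Poly_Mapping.single (Poly_Mapping.single a k) 1)"
    proof (induction k)
      case 0
      then show ?case using const[of 1] by simp
    next
      case (Suc k)
      have "Poly_Mapping.single (Poly_Mapping.single a (Suc k)) 1 =
          Var a * Poly_Mapping.single (Poly_Mapping.single a k) 1"
        by (simp add: Var_def mult_single flip: single_add)
      then show ?case using Suc Var mult by simp
    qed
    moreover have "Poly_Mapping.single (Poly_Mapping.single a k) c =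
        of_int c * Poly_Mapping.single (Poly_Mapping.single a k) 1"
      by (subst single_of_int[symmetric]) (simp only: mult_single, simp)
    ultimately show ?case using const mult by simp
  next
    case (add m n)
    have "Poly_Mapping.single (m + n) c = Poly_Mapping.single m c * Poly_Mapping.single n 1"
      by (simp add: mult_single)
    then show ?case using add mult by simp
  qed
qed (rule add)

lemma Var_eq_iff: "Var a = Var b \<longleftrightarrow> a = b"
proof
  assume "Var a = Var b"
  then have "Poly_Mapping.single a 1 = Poly_Mapping.single b (1::nat)"
    unfolding Var_def by (metis keys_single singleton_inject zero_neq_one)
  then show "a = b" by (metis keys_single singleton_inject zero_neq_one)
qed simp

subsection \<open>Divided differences\<close>

abbreviation X :: "nat \<Rightarrow> mpoly" where "X i \<equiv> Var (x_ind i)"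
abbreviation Y :: "nat \<Rightarrow> mpoly" where "Y i \<equiv> Var (y_ind i)"
abbreviation Z :: "nat \<Rightarrow> mpoly" where "Z i \<equiv> Var (z_ind i)"

lemma act_hom:
  "act i (P + Q) = act i P + act i Q" "act i (P - Q) = act i P - act i Q"
  "act i (P * Q) = act i P * act i Q" "act i (sum f A) = (\<Sum>a\<in>A. act i (f a))"
  "act i (prod f A) = (\<Prod>a\<in>A. act i (f a))"
  by (simp_all add: act_def subst_poly_hom)

lemma act_of_int [simp]: "act i (of_int c) = of_int c"
  and act_0 [simp]: "act i 0 = 0"
  and act_1 [simp]: "act i 1 = 1"
  and act_X [simp]: "act i (X j) = X (adj i j)"
  and act_Y [simp]: "act i (Y j) = Y j"
  and act_Z [simp]: "act i (Z j) = Z j"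
  by (simp_all add: act_def)

lemma adj_simps [simp]:
  "adj i i = Suc i" "adj i (Suc i) = i" "j \<noteq> i \<Longrightarrow> j \<noteq> Suc i \<Longrightarrow> adj i j = j" "adj i (adj i j) = j"
  by (simp_all add: adj_def)

lemma adj_comp_adj [simp]: "adj i \<circ> adj i = id"
  by (simp add: fun_eq_iff)

lemma act_act [simp]: "act i (act i P) = P"
proof (induction P rule: mpoly_induct)
  case (Var a)
  then show ?case by (cases a) simp_all
qed (simp_all add: act_hom)

lemma X_diff_neq_0: "i \<noteq> j \<Longrightarrow> X i - X j \<noteq> 0"
  by (simp add: Var_eq_iff)

lemma divided_difference_exists: "\<exists>Q. (X i - X (i + 1)) * Q = P - act i P"
proof (induction P rule: mpoly_induct)
  case (const c)
  then show ?case by (intro exI[of _ 0]) simp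
next
  case (Var a)
  show ?case
  proof (cases a)
    case (x_ind j)
    consider "j = i" | "j = Suc i" | "j \<noteq> i" "j \<noteq> Suc i" by blast
    then show ?thesis
    proof cases
      case 1
      then show ?thesis using x_ind by (intro exI[of _ 1]) simp
    next
      case 2
      then show ?thesis using x_ind by (intro exI[of _ "-1"]) simp
    next
      case 3
      then show ?thesis using x_ind by (intro exI[of _ 0]) simp
    qed
  qed (auto intro: exI[of _ 0])
next
  case (add P Q)
  then obtain P' Q' where "(X i - X (i + 1)) * P' = P - act i P" "(X i - X (i + 1)) * Q' = Q - act i Q"
    by blast
  then show ?case by (intro exI[of _ "P' + Q'"]) (simp add: act_hom distrib_left)
next
  case (mult P Q)
  then obtain P' Q' where *: "(X i - X (i + 1)) * P' = P - act i P" "(X i - X (i + 1)) * Q' = Q - act i Q"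
    by blast
  \<comment> \<open>The witness is the twisted Leibniz rule for divided differences.\<close>
  have "(X i - X (i + 1)) * (P' * Q + act i P * Q') =
      ((X i - X (i + 1)) * P') * Q + act i P * ((X i - X (i + 1)) * Q')"
    by (simp only: distrib_left mult_ac)
  also have "\<dots> = P * Q - act i (P * Q)"
    by (simp only: *) (simp add: act_hom algebra_simps)
  finally show ?case by blast
qed

text \<open>Replaces the definite description by an equation. With \<open>divdiff_eqI\<close>,
  operators are compared after multiplication by \<open>X i - X (Suc i)\<close>, which is cancelled
  in the integral domain.\<close>

lemma divdiff_mult_cancel: "(X i - X (Suc i)) * divdiff i P = P - act i P"
proof -
  have "\<exists>!Q. (X i - X (i + 1)) * Q = P - act i P"
    using divided_difference_exists[of i P] X_diff_neq_0[of i "i + 1"]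
    by (metis mult_left_cancel n_not_Suc_n Suc_eq_plus1)
  then show ?thesis using theI' unfolding divdiff_def by (metis (mono_tags, lifting) Suc_eq_plus1)
qed

lemma divdiff_eqI: "(X i - X (Suc i)) * Q = P - act i P \<Longrightarrow> divdiff i P = Q"
  using divdiff_mult_cancel[of i P] X_diff_neq_0[of i "Suc i"] by (metis mult_left_cancel n_not_Suc_n)

lemma divdiff_add: "divdiff i (P + Q) = divdiff i P + divdiff i Q"
  by (rule divdiff_eqI) (simp add: distrib_left divdiff_mult_cancel act_hom)

lemma divdiff_sum: "divdiff i (sum f A) = (\<Sum>a\<in>A. divdiff i (f a))"
  by (induction A rule: infinite_finite_induct) (auto simp: divdiff_add intro: divdiff_eqI)

lemma divdiff_symmetric: "act i P = P \<Longrightarrow> divdiff i P = 0"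
  by (rule divdiff_eqI) simp

lemma act_eq_of_divdiff_0: "divdiff i P = 0 \<Longrightarrow> act i P = P"
  using divdiff_mult_cancel[of i P] by simp

lemma divdiff_mult_left: "act i c = c \<Longrightarrow> divdiff i (c * P) = c * divdiff i P"
  by (rule divdiff_eqI)
    (metis act_hom(3) divdiff_mult_cancel mult.left_commute right_diff_distrib)

text \<open>The twisted Leibniz rule for the factor \<open>X i\<close>, whose divided difference is
  \<open>1\<close>. The summand \<open>P\<close> here, and \<open>- P\<close> in the next lemma,
  yields the term of Monk's formula that \<open>monk_adj\<close> cannot obtain from a cover.\<close>

lemma divdiff_X_mult: "divdiff i (X i * P) = P + X (Suc i) * divdiff i P"
proof (rule divdiff_eqI)
  have "(X i - X (Suc i)) * (P + X (Suc i) * divdiff i P) =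
      (X i - X (Suc i)) * P + X (Suc i) * ((X i - X (Suc i)) * divdiff i P)"
    by (simp add: algebra_simps)
  then show "(X i - X (Suc i)) * (P + X (Suc i) * divdiff i P) = X i * P - act i (X i * P)"
    by (simp only: divdiff_mult_cancel) (simp add: act_hom algebra_simps)
qed

lemma divdiff_X_Suc_mult: "divdiff i (X (Suc i) * P) = X i * divdiff i P - P"
proof (rule divdiff_eqI)
  have "(X i - X (Suc i)) * (X i * divdiff i P - P) =
      X i * ((X i - X (Suc i)) * divdiff i P) - (X i - X (Suc i)) * P"
    by (simp add: algebra_simps)
  then show "(X i - X (Suc i)) * (X i * divdiff i P - P) = X (Suc i) * P - act i (X (Suc i) * P)"
    by (simp only: divdiff_mult_cancel) (simp add: act_hom algebra_simps)
qed

text \<open>Numerator \<open>P - act i P\<close> and denominator both change sign under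
  \<open>act i\<close>.\<close>

lemma act_divdiff: "act i (divdiff i P) = divdiff i P"
proof -
  have "(X i - X (Suc i)) * act i (divdiff i P) = - act i ((X i - X (Suc i)) * divdiff i P)"
    by (simp add: act_hom algebra_simps)
  also have "\<dots> = (X i - X (Suc i)) * divdiff i P"
    by (simp only: divdiff_mult_cancel) (simp add: act_hom)
  finally show ?thesis using X_diff_neq_0[of i "Suc i"] by (metis mult_left_cancel n_not_Suc_n)
qed

lemma divdiff_divdiff [simp]: "divdiff i (divdiff i P) = 0"
  by (simp add: divdiff_symmetric act_divdiff)

lemma act_commute:
  assumes "\<And>j. adj i (adj k j) = adj k (adj i j)"
  shows "act i (act k P) = act k (act i P)"
proof (induction P rule: mpoly_induct)
  case (Var a)
  then show ?case by (cases a) (simp_all add: assms)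
qed (simp_all add: act_hom)

lemma act_braid: "act i (act (Suc i) (act i P)) = act (Suc i) (act i (act (Suc i) P))"
proof (induction P rule: mpoly_induct)
  case (Var a)
  then show ?case by (cases a) (simp_all add: adj_def transpose_def)
qed (simp_all add: act_hom)

lemma divdiff_commute:
  assumes "Suc i < k"
  shows "divdiff i (divdiff k P) = divdiff k (divdiff i P)"
proof -
  let ?a = "X i - X (Suc i)" and ?b = "X k - X (Suc k)"
  have com: "act i (act k Q) = act k (act i Q)" for Q
    using assms by (intro act_commute) (auto simp: adj_def transpose_def)
  have fix_b: "act i ?b = ?b" "act k ?a = ?a" using assms by (simp_all add: act_hom)
  \<comment> \<open>Multiplied by \<open>?a * ?b\<close>, both sides become
    \<open>P - act i P - act k P + act i (act k P)\<close>, which is symmetric in \<open>i\<close>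
    and \<open>k\<close> as the two actions commute.\<close>
  have "?a * (?b * divdiff i (divdiff k P)) = ?b * (?a * divdiff i (divdiff k P))"
    by (simp only: mult_ac)
  also have "\<dots> = ?b * divdiff k P - act i (?b * divdiff k P)"
    by (metis act_hom(3) fix_b(1) divdiff_mult_cancel right_diff_distrib)
  also have "\<dots> = ?a * divdiff i P - act k (?a * divdiff i P)"
    by (simp only: divdiff_mult_cancel) (simp add: act_hom com)
  also have "\<dots> = ?a * (?b * divdiff k (divdiff i P))"
    by (metis act_hom(3) fix_b(2) divdiff_mult_cancel right_diff_distrib)
  finally show ?thesis
    using X_diff_neq_0[of i "Suc i"] X_diff_neq_0[of k "Suc k"] by (metis mult_left_cancel n_not_Suc_n)
qed

text \<open>
  Multiplied by the Vandermonde product in \<open>x\<^sub>i, x\<^sub>i\<^sub>+\<^sub>1, x\<^sub>i\<^sub>+\<^sub>2\<close>, both sides become the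
  antisymmetrisation of \<open>P\<close> in these variables.
\<close>

lemma divdiff_braid:
  "divdiff i (divdiff (Suc i) (divdiff i P)) = divdiff (Suc i) (divdiff i (divdiff (Suc i) P))"
proof -
  define a b c where "a = X i - X (Suc i)" and "b = X (Suc i) - X (Suc (Suc i))"
    and "c = X i - X (Suc (Suc i))"
  define s t where "s = act i" and "t = act (Suc i)"
  have a: "a * divdiff i Q = Q - s Q" and b: "b * divdiff (Suc i) Q = Q - t Q" for Q
    by (simp_all add: a_def b_def s_def t_def divdiff_mult_cancel)
  have vals: "s a = - a" "s b = c" "s c = b" "t a = c" "t b = - b" "t c = a"
    by (simp_all add: s_def t_def a_def b_def c_def act_hom)
  have hom: "s (p - q) = s p - s q" "s (p * q) = s p * s q"
       "t (p - q) = t p - t q" "t (p * q) = t p * t q" for p q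
    by (simp_all add: s_def t_def act_hom)
  have st: "s (s p) = p" "t (t p) = p" "s (t (s p)) = t (s (t p))" for p
    by (simp_all add: s_def t_def act_braid)
  define D where "D = divdiff i P"
  define E where "E = divdiff (Suc i) D"
  define D' where "D' = divdiff (Suc i) P"
  define E' where "E' = divdiff i D'"
  have 1: "a * b * c * divdiff i E = (b * E) * c - s (b * E) * b"
  proof -
    have "a * b * c * divdiff i E = b * c * (a * divdiff i E)" by (simp only: mult_ac)
    then show ?thesis by (simp only: a) (simp add: hom vals algebra_simps)
  qed
  have 2: "b * E = D - t D" unfolding E_def by (rule b)
  have 3: "a * D = P - s P" unfolding D_def by (rule a)
  have d1: "a * b * c * divdiff (Suc i) E' = (a * E') * c - t (a * E') * a"
  proof -
    have "a * b * c * divdiff (Suc i) E' = a * c * (b * divdiff (Suc i) E')" by (simp only: mult_ac)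
    then show ?thesis by (simp only: b) (simp add: hom vals algebra_simps)
  qed
  have d2: "a * E' = D' - s D'" unfolding E'_def by (rule a)
  have d3: "b * D' = P - t P" unfolding D'_def by (rule b)
  have sD: "s D = D" unfolding s_def D_def by (rule act_divdiff)
  have tD: "t D' = D'" unfolding t_def D'_def by (rule act_divdiff)
  \<comment> \<open>Since \<open>s D = D\<close> and \<open>c - b = a\<close>, the two multiples of
    \<open>D\<close> combine to \<open>a * D\<close>. The remaining two terms are the images of
    \<open>a * D\<close> under \<open>t\<close> and \<open>s t\<close>, because these carry
    \<open>a\<close> to \<open>c\<close> and to \<open>b\<close>.\<close>
  have "a * b * c * divdiff i E = a * D - c * t D + b * s (t D)"
    unfolding 1 2 by (simp add: hom sD algebra_simps c_def a_def b_def)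
  also have "c * t D = t (a * D)" by (simp add: hom vals)
  also have "b * s (t D) = s (t (a * D))" by (simp add: hom vals)
  finally have L: "a * b * c * divdiff i E = P - s P - (t P - t (s P)) + (s (t P) - s (t (s P)))"
    unfolding 3 by (simp add: hom)
  have "a * b * c * divdiff (Suc i) E' = b * D' - c * s D' + a * t (s D')"
    unfolding d1 d2 by (simp add: hom tD algebra_simps c_def a_def b_def)
  also have "c * s D' = s (b * D')" by (simp add: hom vals)
  also have "a * t (s D') = t (s (b * D'))" by (simp add: hom vals)
  finally have R: "a * b * c * divdiff (Suc i) E' = P - t P - (s P - s (t P)) + (t (s P) - t (s (t P)))"
    unfolding d3 by (simp add: hom)
  have "a * b * c * divdiff i E = a * b * c * divdiff (Suc i) E'"
    unfolding L R by (simp add: st)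
  moreover have "a * b * c \<noteq> 0"
    using X_diff_neq_0[of i "Suc i"] X_diff_neq_0[of "Suc i" "Suc (Suc i)"] X_diff_neq_0[of i "Suc (Suc i)"]
    unfolding a_def b_def c_def by (metis mult_eq_0_iff n_not_Suc_n Suc_n_not_n lessI less_Suc_eq nat_neq_iff)
  ultimately show ?thesis
    unfolding E_def E'_def D_def D'_def by (metis mult_left_cancel)
qed

lemma divdiff_y_to_z:
  "subst_poly (\<lambda>a. Var (y_to_z_indet a)) (divdiff i P) =
    divdiff i (subst_poly (\<lambda>a. Var (y_to_z_indet a)) P)"
proof -
  let ?f = "subst_poly (\<lambda>a. Var (y_to_z_indet a))"
  have com: "?f (act i P) = act i (?f P)" for P
  proof (induction P rule: mpoly_induct)
    case (Var a)
    then show ?case by (cases a) simp_all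
  qed (simp_all add: act_hom subst_poly_hom)
  have "?f ((X i - X (Suc i)) * divdiff i P) = (X i - X (Suc i)) * ?f (divdiff i P)"
    by (simp add: subst_poly_hom)
  then show ?thesis
    by (intro divdiff_eqI[symmetric]) (simp add: divdiff_mult_cancel subst_poly_hom com)
qed

section \<open>Permutations\<close>

subsection \<open>Lengths\<close>

lemma S_inftyI: "u permutes {1..n} \<Longrightarrow> u \<in> S_infty"
  by (auto simp: S_infty_def)

lemma S_infty_bij: "u \<in> S_infty \<Longrightarrow> bij u"
  by (auto simp: S_infty_def permutes_bij)

lemma S_infty_inj: "u \<in> S_infty \<Longrightarrow> u i = u j \<longleftrightarrow> i = j"
  using S_infty_bij[of u] by (simp add: bij_is_inj inj_eq)

lemma S_infty_pos: "u \<in> S_infty \<Longrightarrow> 1 \<le> u i \<longleftrightarrow> 1 \<le> i"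
  unfolding S_infty_def by (auto dest: permutes_in_image[of _ _ i])
    (metis (no_types, lifting) One_nat_def atLeastAtMost_iff permutes_in_image permutes_not_in)+

lemma permutes_mono: "u permutes {1..m} \<Longrightarrow> m \<le> n \<Longrightarrow> u permutes {1..n::nat}"
  by (erule permutes_subset) auto

lemma S_infty_permutes_above:
  assumes "u \<in> S_infty"
  obtains n where "m \<le> n" "u permutes {1..n + 1}"
proof -
  obtain k where "u permutes {1..k}" using assms by (auto simp: S_infty_def)
  then have "u permutes {1..(m + k) + 1}" by (rule permutes_mono) simp
  then show ?thesis using that[of "m + k"] by simp
qed

lemma S_infty_id [simp]: "id \<in> S_infty"
  by (rule S_inftyI[of _ 0]) simp

lemma S_infty_comp [simp]: "u \<in> S_infty \<Longrightarrow> v \<in> S_infty \<Longrightarrow> u \<circ> v \<in> S_infty"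
proof -
  assume "u \<in> S_infty" "v \<in> S_infty"
  then obtain m n where "u permutes {1..m}" "v permutes {1..n}" by (auto simp: S_infty_def)
  then have "u permutes {1..max m n}" "v permutes {1..max m n}"
    using permutes_mono[OF _ max.cobounded1[of m n]] permutes_mono[OF _ max.cobounded2[of n m]] by blast+
  then show ?thesis by (intro S_inftyI[of _ "max m n"] permutes_compose)
qed

lemma S_infty_inv [simp]: "u \<in> S_infty \<Longrightarrow> inv u \<in> S_infty"
  unfolding S_infty_def using permutes_inv by blast

lemma S_infty_transpose [simp]: "1 \<le> a \<Longrightarrow> 1 \<le> b \<Longrightarrow> transpose a b \<in> S_infty"
  by (rule S_inftyI[of _ "max a b"]) (auto intro: permutes_swap_id)

lemma S_infty_adj [simp]: "1 \<le> i \<Longrightarrow> adj i \<in> S_infty"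
  by (simp add: adj_def)

lemma inv_adj [simp]: "inv (adj i) = adj i"
  by (rule inv_unique_comp) simp_all

lemma bij_adj [simp]: "bij (adj i)"
  by (simp add: adj_def)

lemma S_infty_inv_comp:
  assumes "u \<in> S_infty"
  shows "u \<circ> inv u = id" "inv u \<circ> u = id" "inv (inv u) = u"
  using S_infty_bij[OF assms] by (simp_all add: surj_iff[symmetric] bij_is_surj bij_is_inj inv_inv_eq)

lemma S_infty_apply_inv:
  assumes "u \<in> S_infty"
  shows "u (inv u x) = x" "inv u (u x) = x"
  using S_infty_inv_comp[OF assms] by (metis comp_eq_dest_lhs id_apply)+

definition inversions :: "(nat \<Rightarrow> nat) \<Rightarrow> (nat \<times> nat) set" where
  "inversions u = {(i, j). 1 \<le> i \<and> i < j \<and> u i > u j}"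

lemma finite_inversions: "u \<in> S_infty \<Longrightarrow> finite (inversions u)"
proof -
  assume "u \<in> S_infty"
  then obtain n where u: "u permutes {1..n}" by (auto simp: S_infty_def)
  have "j \<le> n" if "i < j" "u j < u i" for i j
  proof (rule ccontr)
    assume "\<not> j \<le> n"
    then have "u j = j" using permutes_not_in[OF u] by simp
    then show False
      using that \<open>\<not> j \<le> n\<close> permutes_in_image[OF u, of i] permutes_not_in[OF u, of i]
      by (cases "i \<in> {1..n}") auto
  qed
  then have "inversions u \<subseteq> {..n} \<times> {..n}" by (fastforce simp: inversions_def)
  then show ?thesis by (rule finite_subset) simp
qed

lemma len_inversions: "len u = card (inversions u)"
  by (simp add: len_def inversions_def)

text \<open>\<open>adj i\<close> keeps the order of every pair of positions except \<open>i\<close>,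
  \<open>Suc i\<close>. It therefore carries the inversions of \<open>u\<close> to those of
  \<open>u \<circ> adj i\<close>, apart from the new one \<open>(i, Suc i)\<close>.\<close>

lemma len_adj:
  assumes u: "u \<in> S_infty" and i: "1 \<le> i" and less: "u i < u (Suc i)"
  shows "len (u \<circ> adj i) = len u + 1"
proof -
  let ?f = "\<lambda>(a, b). (adj i a, adj i b)"
  have mem: "adj i a < adj i b \<longleftrightarrow> a < b" if "\<not> (a = i \<and> b = Suc i)" "\<not> (a = Suc i \<and> b = i)" for a b
    using that by (auto simp: adj_def transpose_def)
  have pos: "1 \<le> adj i a \<longleftrightarrow> 1 \<le> a" for a
    using i by (auto simp: adj_def transpose_def)
  have "inversions (u \<circ> adj i) = insert (i, Suc i) (?f ` inversions u)"
  proof (intro equalityI subsetI)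
    fix p assume p: "p \<in> inversions (u \<circ> adj i)"
    obtain a b where ab: "p = (a, b)" by fastforce
    show "p \<in> insert (i, Suc i) (?f ` inversions u)"
    proof (cases "a = i \<and> b = Suc i")
      case False
      then have "(adj i a, adj i b) \<in> inversions u"
        using p ab mem[of a b] pos[of a] by (auto simp: inversions_def)
      then have "?f (adj i a, adj i b) \<in> ?f ` inversions u" by (rule imageI)
      then show ?thesis using ab by simp
    qed (simp add: ab)
  next
    fix p assume "p \<in> insert (i, Suc i) (?f ` inversions u)"
    then consider "p = (i, Suc i)" | a b where "p = (adj i a, adj i b)" "(a, b) \<in> inversions u"
      by auto
    then show "p \<in> inversions (u \<circ> adj i)"
    proof cases
      case 1
      then show ?thesis using i less by (simp add: inversions_def)
    next
      case 2
      then have "\<not> (a = i \<and> b = Suc i)" using less by (auto simp: inversions_def)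
      moreover have "\<not> (a = Suc i \<and> b = i)" using 2 by (auto simp: inversions_def)
      ultimately show ?thesis using 2 mem[of a b] pos[of a] by (auto simp: inversions_def)
    qed
  qed
  moreover have "(i, Suc i) \<notin> ?f ` inversions u"
  proof
    assume "(i, Suc i) \<in> ?f ` inversions u"
    then obtain a b where "(a, b) \<in> inversions u" "adj i a = i" "adj i b = Suc i" by auto
    then have "a = Suc i" "b = i" by (metis adj_simps(4) adj_simps(1), metis adj_simps(4) adj_simps(2))
    then show False using \<open>(a, b) \<in> inversions u\<close> by (simp add: inversions_def)
  qed
  moreover have "inj_on ?f (inversions u)"
    by (auto simp: inj_on_def) (metis adj_simps(4))+
  ultimately show ?thesis
    using finite_inversions[OF u] by (simp add: len_inversions card_image)
qed

lemma comp_adj_adj [simp]: "u \<circ> adj i \<circ> adj i = u" "adj i \<circ> (adj i \<circ> u) = u"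
  by (simp add: comp_assoc, simp add: comp_assoc[symmetric])

lemma len_adj_descent:
  assumes u: "u \<in> S_infty" and i: "1 \<le> i" and less: "u (Suc i) < u i"
  shows "len u = len (u \<circ> adj i) + 1"
  using len_adj[of "u \<circ> adj i" i] assms by simp

lemma ascent_or_descent:
  assumes "u \<in> S_infty" obtains "u i < u (Suc i)" | "u (Suc i) < u i"
  using S_infty_inj[OF assms, of i "Suc i"] by (meson n_not_Suc_n nat_neq_iff)

lemma len_adj_less_iff:
  assumes "u \<in> S_infty" "1 \<le> i"
  shows "len u < len (u \<circ> adj i) \<longleftrightarrow> u i < u (Suc i)"
proof (rule ascent_or_descent[OF assms(1), of i])
  assume "u i < u (Suc i)"
  then show ?thesis using len_adj[OF assms] by simp
next
  assume "u (Suc i) < u i"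
  then show ?thesis using len_adj_descent[OF assms] by simp
qed

lemma len_adj_bounds:
  assumes "u \<in> S_infty" "1 \<le> i"
  shows "len (u \<circ> adj i) \<le> len u + 1" "len u \<le> len (u \<circ> adj i) + 1"
proof -
  have "len (u \<circ> adj i) \<le> len u + 1 \<and> len u \<le> len (u \<circ> adj i) + 1"
  proof (rule ascent_or_descent[OF assms(1), of i])
    assume "u i < u (Suc i)"
    then show ?thesis using len_adj[OF assms] by simp
  next
    assume "u (Suc i) < u i"
    then show ?thesis using len_adj_descent[OF assms] by simp
  qed
  then show "len (u \<circ> adj i) \<le> len u + 1" "len u \<le> len (u \<circ> adj i) + 1" by simp_all
qed

text \<open>An inversion of \<open>u\<close>, read through its values, is an inversion of
  \<open>inv u\<close>; this gives one inequality, and the other one by passing to the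
  inverse.\<close>

lemma len_inv:
  assumes "u \<in> S_infty"
  shows "len (inv u) = len u"
proof -
  have sub: "(\<lambda>(a, b). (u b, u a)) ` inversions u \<subseteq> inversions (inv u)" if "u \<in> S_infty" for u
  proof clarify
    fix a b assume "(a, b) \<in> inversions u"
    then have "1 \<le> a" "a < b" "u b < u a" by (auto simp: inversions_def)
    then show "(u b, u a) \<in> inversions (inv u)"
      using S_infty_pos[OF that, of b] by (simp add: inversions_def S_infty_apply_inv that)
  qed
  have le: "len u \<le> len (inv u)" if "u \<in> S_infty" for u
    unfolding len_inversions
    by (rule card_inj_on_le[OF _ sub[OF that]])
      (auto simp: inj_on_def S_infty_inj[OF that] finite_inversions that)
  show ?thesis using le[OF assms] le[of "inv u"] assms by (simp add: S_infty_inv_comp)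
qed

lemma len_id [simp]: "len id = 0"
proof -
  have "inversions id = {}" by (auto simp: inversions_def)
  then show ?thesis by (simp add: len_inversions)
qed

section \<open>General transpositions and covers in the Bruhat order\<close>

lemma comp_transpose_split:
  assumes "distinct [a, b, c]"
  shows "u \<circ> transpose a b = u \<circ> transpose a c \<circ> transpose c b \<circ> transpose a c"
  using assms by (auto simp: fun_eq_iff transpose_def)

text \<open>Induction on \<open>b - a\<close>: conjugation with \<open>adj a\<close> reduces the
  transposition to \<open>Suc a\<close>, \<open>b\<close>, where the length increases. Of the two
  outer factors, each changes the length by one, and they cannot both lower it: if the first does,
  then \<open>u (Suc a) < u a < u b\<close> makes the last one raise it.\<close>

lemma len_transpose_less:
  assumes "u \<in> S_infty" "1 \<le> a" "a < b" "u a < u b"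
  shows "len u < len (u \<circ> transpose a b)"
  using assms
proof (induction "b - a" arbitrary: u a rule: less_induct)
  case less
  note u = less.prems(1) and a = less.prems(2)
  show ?case
  proof (cases "b = Suc a")
    case True
    then show ?thesis using len_adj[OF u a] less.prems by (simp add: adj_def)
  next
    case False
    let ?v = "u \<circ> adj a" and ?w = "u \<circ> adj a \<circ> transpose (Suc a) b"
    have split: "u \<circ> transpose a b = ?w \<circ> adj a"
      using False less.prems comp_transpose_split[of a b "Suc a" u] by (simp add: adj_def)
    have v: "?v \<in> S_infty" using u a by simp
    have w: "?w \<in> S_infty" using u a less.prems by simp
    have "?v (Suc a) < ?v b" using less.prems False by simp
    then have vw: "len ?v < len ?w"
      using less.hyps[OF _ v, of "Suc a"] less.prems False by simp
    show ?thesis unfolding split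
    proof (rule ascent_or_descent[OF u, of a])
      assume "u a < u (Suc a)"
      then show "len u < len (?w \<circ> adj a)"
        using len_adj[OF u a] vw len_adj_bounds(2)[OF w a] by simp
    next
      assume desc: "u (Suc a) < u a"
      have "?w a = u (Suc a)" "?w (Suc a) = u b"
        using less.prems False by (simp_all add: transpose_def)
      then have "?w a < ?w (Suc a)" using desc less.prems by simp
      then show "len u < len (?w \<circ> adj a)"
        using len_adj_descent[OF u a desc] vw len_adj[OF w a] by simp
    qed
  qed
qed

lemma comp_transpose_twice [simp]: "u \<circ> transpose a b \<circ> transpose a b = u"
  by (simp add: comp_assoc)

lemma len_transpose_less_iff:
  assumes u: "u \<in> S_infty" and ab: "1 \<le> a" "a < b"
  shows "len u < len (u \<circ> transpose a b) \<longleftrightarrow> u a < u b"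
proof
  assume "len u < len (u \<circ> transpose a b)"
  moreover have "len (u \<circ> transpose a b) < len u" if "u b < u a"
    using len_transpose_less[of "u \<circ> transpose a b" a b] u ab that by simp
  ultimately show "u a < u b"
    using S_infty_inj[OF u, of a b] ab by (metis less_asym less_irrefl nat_neq_iff)
qed (rule len_transpose_less[OF assms])

text \<open>Symmetric in \<open>a\<close> and \<open>b\<close>, so that one index set serves the
  positive and the negative terms of Monk's formula.\<close>

definition covers :: "(nat \<Rightarrow> nat) \<Rightarrow> nat \<Rightarrow> nat \<Rightarrow> bool" where
  "covers u a b \<longleftrightarrow> 1 \<le> a \<and> 1 \<le> b \<and> a \<noteq> b \<and> len (u \<circ> transpose a b) = len u + 1"

lemma covers_commute: "covers u a b \<longleftrightarrow> covers u b a"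
  by (auto simp: covers_def transpose_commute)

lemma covers_less: "u \<in> S_infty \<Longrightarrow> covers u a b \<Longrightarrow> a < b \<Longrightarrow> u a < u b"
  unfolding covers_def by (metis len_transpose_less_iff less_add_one)

text \<open>An intermediate value at \<open>c\<close> would split the transposition into three
  transpositions each of which raises the length, so the total increase would be at least
  three.\<close>

lemma covers_not_between:
  assumes u: "u \<in> S_infty" and cov: "covers u a b" and c: "a < c" "c < b"
  shows "\<not> (u a < u c \<and> u c < u b)"
proof
  assume mid: "u a < u c \<and> u c < u b"
  have a: "1 \<le> a" "1 \<le> c" "1 \<le> b" using cov c by (auto simp: covers_def)
  let ?v = "u \<circ> transpose a c"
  let ?w = "?v \<circ> transpose c b"
  have "len u + 1 \<le> len ?v" using len_transpose_less[OF u, of a c] a c mid by simp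
  moreover have "len ?v + 1 \<le> len ?w"
    using len_transpose_less[of ?v c b] u a c mid by simp
  moreover have "len ?w + 1 \<le> len (?w \<circ> transpose a c)"
    using len_transpose_less[of ?w a c] u a c mid by (simp add: transpose_def)
  ultimately have "len u + 2 < len (?w \<circ> transpose a c)" by linarith
  moreover have "?w \<circ> transpose a c = u \<circ> transpose a b"
    using c comp_transpose_split[of a b c u] by simp
  ultimately show False using cov by (auto simp: covers_def simp del: comp_apply)
qed

text \<open>The induction of \<open>len_transpose_less\<close> with exact lengths: if the first
  outer factor raises the length, then \<open>u (Suc a)\<close> must exceed \<open>u b\<close>, as
  it is not between, and the last factor lowers it again.\<close>

lemma coversI:
  assumes "u \<in> S_infty" "1 \<le> a" "a < b" "u a < u b"
    and "\<And>c. a < c \<Longrightarrow> c < b \<Longrightarrow> \<not> (u a < u c \<and> u c < u b)"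
  shows "covers u a b"
  using assms
proof (induction "b - a" arbitrary: u a rule: less_induct)
  case less
  note u = less.prems(1) and a = less.prems(2)
  show ?case
  proof (cases "b = Suc a")
    case True
    then show ?thesis using len_adj[OF u a] less.prems by (simp add: adj_def covers_def)
  next
    case False
    let ?v = "u \<circ> adj a" and ?w = "u \<circ> adj a \<circ> transpose (Suc a) b"
    have split: "u \<circ> transpose a b = ?w \<circ> adj a"
      using False less.prems comp_transpose_split[of a b "Suc a" u] by (simp add: adj_def)
    have v: "?v \<in> S_infty" using u a by simp
    have w: "?w \<in> S_infty" using u a less.prems by simp
    have "?v (Suc a) < ?v b" using less.prems False by simp
    moreover have "\<not> (?v (Suc a) < ?v c \<and> ?v c < ?v b)" if "Suc a < c" "c < b" for c
      using less.prems(5)[of c] that False by simp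
    ultimately have "covers ?v (Suc a) b"
      using less.hyps[OF _ v, of "Suc a"] less.prems False by simp
    then have vw: "len ?w = len ?v + 1" by (simp add: covers_def)
    have wa: "?w a = u (Suc a)" "?w (Suc a) = u b"
      using less.prems False by (simp_all add: transpose_def)
    have "len (?w \<circ> adj a) = len u + 1"
    proof (rule ascent_or_descent[OF u, of a])
      assume asc: "u a < u (Suc a)"
      then have "u b < u (Suc a)"
        using less.prems(3) less.prems(5)[of "Suc a"] False S_infty_inj[OF u, of "Suc a" b]
        by (meson Suc_lessI lessI nat_neq_iff)
      then show ?thesis
        using len_adj[OF u a asc] vw len_adj_descent[OF w a] wa by simp
    next
      assume desc: "u (Suc a) < u a"
      then have "?w a < ?w (Suc a)" using wa less.prems by simp
      then show ?thesis
        using len_adj_descent[OF u a desc] vw len_adj[OF w a] by simp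
    qed
    then show ?thesis using split less.prems by (simp add: covers_def)
  qed
qed

text \<open>For larger \<open>b\<close>, the fixed point \<open>Suc n\<close> would lie between
  \<open>a\<close> and \<open>b\<close> both in position and in value.\<close>

lemma covers_bounded:
  assumes u: "u permutes {1..n}" and a: "a \<le> n" and cov: "covers u a b"
  shows "b \<le> Suc n"
proof (rule ccontr)
  assume b: "\<not> b \<le> Suc n"
  have "u b = b" "u (Suc n) = Suc n" using b permutes_not_in[OF u] by auto
  moreover have "u a \<le> n"
    using a cov permutes_in_image[OF u, of a] by (simp add: covers_def)
  ultimately show False
    using covers_not_between[OF S_inftyI[OF u] cov, of "Suc n"] a b by auto
qed

lemma finite_covers:
  assumes "u \<in> S_infty"
  shows "finite {b. covers u a b}"
proof -
  obtain n where "a \<le> n" "u permutes {1..n + 1}" using S_infty_permutes_above[OF assms] .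
  then have "{b. covers u a b} \<subseteq> {..n + 2}" using covers_bounded[of u "n + 1" a] by auto
  then show ?thesis by (rule finite_subset) simp
qed

section \<open>Descents and the longest permutations\<close>

lemma no_descent_imp_id:
  assumes u: "u permutes {1..n}" and asc: "\<And>i. 1 \<le> i \<Longrightarrow> i < n \<Longrightarrow> u i < u (Suc i)"
  shows "u = id"
proof (rule permutes_natset_ge[OF u])
  have "i \<le> n \<longrightarrow> i \<le> u i" for i
  proof (induction i)
    case (Suc i)
    show ?case
    proof (cases "i = 0")
      case True
      then show ?thesis using permutes_in_image[OF u, of 1] by auto
    next
      case False
      then show ?thesis using Suc asc[of i] by auto
    qed
  qed simp
  then show "\<forall>i\<in>{1..n}. i \<le> u i" by simp
qed

lemma exists_descent:
  assumes u: "u \<in> S_infty" "u \<noteq> id"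
  obtains i where "1 \<le> i" "u (Suc i) < u i"
proof -
  obtain n where "u permutes {1..n}" using u by (auto simp: S_infty_def)
  then obtain i where i: "1 \<le> i" "\<not> u i < u (Suc i)" using no_descent_imp_id u(2) by blast
  then have "u (Suc i) < u i" using S_infty_inj[OF u(1), of i "Suc i"] by (meson n_not_Suc_n nat_neq_iff)
  then show ?thesis using that i by blast
qed

lemma w0_permutes: "w0 n permutes {1..n + 1}"
proof (rule bij_imp_permutes)
  have "w0 n ` {1..n + 1} \<subseteq> {1..n + 1}" "\<forall>i\<in>{1..n + 1}. w0 n (w0 n i) = i"
    by (auto simp: w0_def)
  then show "bij_betw (w0 n) {1..n + 1} {1..n + 1}" by (intro bij_betw_byWitness[of _ "w0 n"]) auto
qed (auto simp: w0_def)

lemma w0_w0 [simp]: "w0 n (w0 n i) = i" "w0 n \<circ> w0 n = id"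
  by (auto simp: w0_def fun_eq_iff)

lemma inv_w0 [simp]: "inv (w0 n) = w0 n"
  by (rule inv_unique_comp) simp_all

text \<open>If \<open>u\<close> decreases on \<open>{1..n + 1}\<close>, its values read backwards
  increase, so \<open>u \<circ> w0 n\<close> is the identity.\<close>

lemma eq_w0_or_ascent:
  assumes u: "u permutes {1..n + 1}"
  obtains "u = w0 n" | i where "1 \<le> i" "i \<le> n" "u i < u (Suc i)"
proof -
  have "u = w0 n" if no: "\<nexists>i. 1 \<le> i \<and> i \<le> n \<and> u i < u (Suc i)"
  proof -
    have "u \<circ> w0 n = id"
    proof (rule no_descent_imp_id)
      show "u \<circ> w0 n permutes {1..n + 1}" using u w0_permutes by (rule permutes_compose[rotated])
      fix i assume i: "1 \<le> i" "i < n + 1"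
      have "\<not> u (n + 1 - i) < u (Suc (n + 1 - i))" using no i by auto
      moreover have "u (n + 1 - i) \<noteq> u (Suc (n + 1 - i))" by (simp add: inj_eq[OF permutes_inj[OF u]])
      ultimately show "(u \<circ> w0 n) i < (u \<circ> w0 n) (Suc i)"
        using i by (simp add: w0_def Suc_diff_le)
    qed
    then show ?thesis by (metis comp_assoc comp_id id_comp w0_w0(2))
  qed
  then show ?thesis using that by blast
qed

lemma len_le_square:
  assumes u: "u permutes {1..n}"
  shows "len u \<le> n * n"
proof -
  have "inversions u \<subseteq> {1..n} \<times> {1..n}"
  proof clarify
    fix a b assume "(a, b) \<in> inversions u"
    then have ab: "1 \<le> a" "a < b" "u b < u a" by (auto simp: inversions_def)
    have "b \<le> n"
    proof (rule ccontr)
      assume "\<not> b \<le> n"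
      then show False using ab permutes_not_in[OF u, of b] permutes_in_image[OF u, of a]
        permutes_not_in[OF u, of a] by (cases "a \<in> {1..n}") auto
    qed
    then show "a \<in> {1..n} \<and> b \<in> {1..n}" using ab by simp
  qed
  then have "card (inversions u) \<le> card ({1..n} \<times> {1..n})" by (intro card_mono) auto
  then show ?thesis by (simp add: len_inversions)
qed

lemma permutes_comp_adj: "u permutes {1..n + 1} \<Longrightarrow> 1 \<le> i \<Longrightarrow> i \<le> n \<Longrightarrow> u \<circ> adj i permutes {1..n + 1}"
  unfolding adj_def by (intro permutes_compose[OF permutes_swap_id]) auto

text \<open>Induction from the longest permutations downwards; it terminates because lengths within
  a fixed symmetric group are bounded. For \<open>k = n\<close> the only stopping point is
  \<open>w0 n\<close>, as in stability and Monk's formula. The Pieri formula uses a smaller bound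
  and stops once \<open>u\<close> decreases on an initial interval.\<close>

lemma ascent_induct [consumes 1, case_names stop ascent]:
  assumes u: "u permutes {1..n + 1}"
    and stop: "\<And>u. u permutes {1..n + 1} \<Longrightarrow> (\<nexists>i. 1 \<le> i \<and> i \<le> k \<and> u i < u (Suc i)) \<Longrightarrow> R u"
    and ascent: "\<And>u i. u permutes {1..n + 1} \<Longrightarrow> 1 \<le> i \<Longrightarrow> i \<le> k \<Longrightarrow> u i < u (Suc i) \<Longrightarrow> R (u \<circ> adj i) \<Longrightarrow> R u"
    and k: "k \<le> n"
  shows "R u"
  using u
proof (induction "(n + 1) * (n + 1) - len u" arbitrary: u rule: less_induct)
  case less
  show ?case
  proof (cases "\<exists>i. 1 \<le> i \<and> i \<le> k \<and> u i < u (Suc i)")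
    case True
    then obtain i where i: "1 \<le> i" "i \<le> k" "u i < u (Suc i)" by blast
    have p: "u \<circ> adj i permutes {1..n + 1}" using permutes_comp_adj less.prems i k by simp
    have "len u < len (u \<circ> adj i)" using len_adj[OF S_inftyI[OF less.prems]] i by simp
    moreover have "len (u \<circ> adj i) \<le> (n + 1) * (n + 1)" using len_le_square[OF p] .
    ultimately have "(n + 1) * (n + 1) - len (u \<circ> adj i) < (n + 1) * (n + 1) - len u" by linarith
    then show ?thesis using less.hyps p ascent[OF less.prems i] by blast
  qed (use stop less.prems in blast)
qed

subsection \<open>Reduced words\<close>

lemma word_prod_simps [simp]:
  "word_prod [] = id" "word_prod (i # ws) = adj i \<circ> word_prod ws"
  by (simp_all add: word_prod_def)

lemma word_prod_append: "word_prod (as @ bs) = word_prod as \<circ> word_prod bs"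
  by (induction as) (simp_all add: comp_assoc)

lemma word_prod_in_S_infty: "\<forall>i\<in>set ws. 1 \<le> i \<Longrightarrow> word_prod ws \<in> S_infty"
  by (induction ws) simp_all

lemma reduced_word_in_S_infty: "reduced_word ws u \<Longrightarrow> u \<in> S_infty"
  using word_prod_in_S_infty by (auto simp: reduced_word_def)

lemma len_adj_left:
  assumes "u \<in> S_infty" "1 \<le> i"
  shows "len (adj i \<circ> u) = len (inv u \<circ> adj i)"
proof -
  have "inv (adj i \<circ> u) = inv u \<circ> adj i"
    using S_infty_bij[OF assms(1)] by (simp add: o_inv_distrib)
  then show ?thesis using len_inv[of "adj i \<circ> u"] assms by simp
qed

lemma len_adj_left_bounds:
  assumes "u \<in> S_infty" "1 \<le> i"
  shows "len (adj i \<circ> u) \<le> len u + 1" "len u \<le> len (adj i \<circ> u) + 1"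
  using len_adj_bounds[of "inv u" i] len_adj_left[OF assms] len_inv[OF assms(1)] assms by simp_all

lemma len_word_prod_le: "\<forall>i\<in>set ws. 1 \<le> i \<Longrightarrow> len (word_prod ws) \<le> length ws"
proof (induction ws)
  case (Cons i ws)
  then show ?case
    using len_adj_left_bounds(1)[OF word_prod_in_S_infty, of ws i] by (simp add: comp_def)
qed simp

text \<open>The tail has length at most its number of letters, and one letter changes the length by
  at most one, so both estimates are sharp.\<close>

lemma reduced_word_Cons_D:
  assumes "reduced_word (i # ws) u"
  shows "1 \<le> i" "reduced_word ws (adj i \<circ> u)" "len u = len (adj i \<circ> u) + 1"
proof -
  have *: "1 \<le> i" "\<forall>k\<in>set ws. 1 \<le> k" "adj i \<circ> word_prod ws = u" "len u = length ws + 1"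
    using assms by (auto simp: reduced_word_def)
  then have u: "adj i \<circ> u = word_prod ws" by auto
  have "len (word_prod ws) \<le> length ws" using * len_word_prod_le by blast
  moreover have "len u \<le> len (adj i \<circ> u) + 1"
    using len_adj_left_bounds(2) reduced_word_in_S_infty[OF assms] * by blast
  ultimately show "1 \<le> i" "reduced_word ws (adj i \<circ> u)" "len u = len (adj i \<circ> u) + 1"
    unfolding reduced_word_def u using * u by auto
qed

lemma reduced_word_append:
  assumes "reduced_word c u" "\<forall>i\<in>set p. 1 \<le> i" "len (word_prod p \<circ> u) = len u + length p"
  shows "reduced_word (p @ c) (word_prod p \<circ> u)"
  using assms by (auto simp: reduced_word_def word_prod_append)

lemma exists_reduced_word: "u \<in> S_infty \<Longrightarrow> \<exists>ws. reduced_word ws u"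
proof (induction "len u" arbitrary: u)
  case 0
  have "u = id"
    using exists_descent[OF 0(2)] len_adj_descent[OF 0(2)] 0(1) by (metis add_is_0 zero_neq_one)
  then have "reduced_word [] u" by (simp add: reduced_word_def)
  then show ?case by blast
next
  case (Suc k)
  have "inv u \<noteq> id"
    using Suc.hyps(2) len_inv[OF Suc.prems] by (metis len_id nat.distinct(1))
  then obtain i where i: "1 \<le> i" "inv u (Suc i) < inv u i"
    using exists_descent[of "inv u"] Suc.prems by auto
  then have l: "len u = len (adj i \<circ> u) + 1"
    using len_adj_descent[of "inv u" i] Suc.prems len_inv[OF Suc.prems] len_adj_left[OF Suc.prems i(1)]
    by simp
  moreover have S: "adj i \<circ> u \<in> S_infty" using i Suc.prems by simp
  ultimately obtain ws where "reduced_word ws (adj i \<circ> u)"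
    using Suc.hyps(1)[OF _ S] Suc.hyps(2) by auto
  then have "reduced_word ([i] @ ws) (word_prod [i] \<circ> (adj i \<circ> u))"
    using i l by (intro reduced_word_append) simp_all
  then show ?case by auto
qed

section \<open>Divided differences along reduced words\<close>

lemma divdiff_word_simps [simp]:
  "divdiff_word [] P = P" "divdiff_word (i # ws) P = divdiff i (divdiff_word ws P)"
  by (simp_all add: divdiff_word_def)

text \<open>The induction step of Matsumoto's theorem. Both \<open>adj i\<close> and
  \<open>adj k\<close> shorten \<open>u\<close> from the left, so the longest element of the
  subgroup they generate splits off. By \<open>IH\<close> each word may be replaced by one starting
  with a reduced word of that element, and these two differ by a commutation or a braid
  relation.\<close>

lemma divdiff_word_eq_distinct_heads:
  assumes IH: "\<And>u a b. reduced_word a u \<Longrightarrow> reduced_word b u \<Longrightarrow> length a = n \<Longrightarrow> divdiff_word a P = divdiff_word b P"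
    and a: "reduced_word (i # a) u" and b: "reduced_word (k # b) u" and n: "length a = n"
    and ik: "i < k"
  shows "divdiff_word (i # a) P = divdiff_word (k # b) P"
proof -
  note i = reduced_word_Cons_D[OF a] and k = reduced_word_Cons_D[OF b]
  \<comment> \<open>The heads multiply \<open>u\<close> from the left. On the inverse they act on
    positions, so drops in length can be read off as descents of \<open>v\<close>.\<close>
  define v where "v = inv u"
  have u: "u \<in> S_infty" using reduced_word_in_S_infty[OF a] .
  then have v: "v \<in> S_infty" by (simp add: v_def)
  have inv_comp: "inv (word_prod p \<circ> u) = v \<circ> inv (word_prod p)" if "\<forall>i\<in>set p. 1 \<le> i" for p
    using S_infty_bij[OF u] S_infty_bij[OF word_prod_in_S_infty[OF that]] by (simp add: v_def o_inv_distrib)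
  have descent: "v (Suc m) < v m" if "1 \<le> m" "len u = len (adj m \<circ> u) + 1" for m
    using len_adj_left[OF u that(1)] that len_adj_less_iff[OF v that(1)] len_inv[OF u]
      ascent_or_descent[OF v, of m] by (metis less_add_one not_less_iff_gr_or_eq v_def)
  have vi: "v (Suc i) < v i" and vk: "v (Suc k) < v k" using descent i k by auto
  have nb: "length b = n" using a b n by (simp add: reduced_word_def)
  have transfer: "divdiff_word (i # a) P = divdiff_word (i # a') P"
    if "reduced_word (i # a') u" for a'
    using IH[OF i(2) reduced_word_Cons_D(2)[OF that] n] by simp
  have transfer': "divdiff_word (k # b) P = divdiff_word (k # b') P"
    if "reduced_word (k # b') u" for b'
    using IH[OF k(2) reduced_word_Cons_D(2)[OF that] nb] by simp
  show ?thesis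
  proof (cases "k = Suc i")
    case False
    define u' where "u' = adj k \<circ> (adj i \<circ> u)"
    have com: "adj i \<circ> (adj k \<circ> u') = u" "adj k \<circ> (adj i \<circ> u') = u"
      using False ik by (auto simp: u'_def fun_eq_iff adj_def transpose_def)
    have u': "u' \<in> S_infty" using u i k by (simp add: u'_def)
    then obtain c where c: "reduced_word c u'" using exists_reduced_word by blast
    have "inv u' = v \<circ> adj i \<circ> adj k"
      using inv_comp[of "[k, i]"] i k by (simp add: u'_def o_inv_distrib comp_assoc)
    then have "len u' = len (v \<circ> adj i \<circ> adj k)" using len_inv[OF u'] by simp
    moreover have "len (v \<circ> adj i) = len (v \<circ> adj i \<circ> adj k) + 1"
      using False ik vk v i k by (intro len_adj_descent) simp_all
    moreover have "len v = len (v \<circ> adj i) + 1" using vi v i by (intro len_adj_descent) simp_all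
    ultimately have l: "len u = len u' + 2" using len_inv[OF u] by (simp add: v_def)
    have "reduced_word ([i, k] @ c) u" "reduced_word ([k, i] @ c) u"
      using reduced_word_append[OF c, of "[i, k]"] reduced_word_append[OF c, of "[k, i]"] i k l com
      by (simp_all add: comp_assoc)
    then have "divdiff_word (i # a) P = divdiff_word (i # k # c) P"
      "divdiff_word (k # b) P = divdiff_word (k # i # c) P"
      using transfer transfer' by simp_all
    then show ?thesis using divdiff_commute[of i k "divdiff_word c P"] ik False by simp
  next
    case True
    \<comment> \<open>Here \<open>v\<close> decreases on \<open>i\<close>, \<open>i + 1\<close>,
      \<open>i + 2\<close>, so removing the longest element of the subgroup lowers the length by
      three.\<close>
    define u' where "u' = adj i \<circ> (adj k \<circ> (adj i \<circ> u))"
    have com: "adj i \<circ> (adj k \<circ> (adj i \<circ> u')) = u" "adj k \<circ> (adj i \<circ> (adj k \<circ> u')) = u"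
      using True by (auto simp: u'_def fun_eq_iff adj_def transpose_def)
    have u': "u' \<in> S_infty" using u i k by (simp add: u'_def)
    then obtain c where c: "reduced_word c u'" using exists_reduced_word by blast
    have "inv u' = v \<circ> adj i \<circ> adj k \<circ> adj i"
      using inv_comp[of "[i, k, i]"] i k by (simp add: u'_def o_inv_distrib comp_assoc bij_comp)
    then have "len u' = len (v \<circ> adj i \<circ> adj k \<circ> adj i)" using len_inv[OF u'] by simp
    moreover have "len (v \<circ> adj i \<circ> adj k) = len (v \<circ> adj i \<circ> adj k \<circ> adj i) + 1"
      using True vk vi v i k by (intro len_adj_descent) (simp_all add: adj_def transpose_def)
    moreover have "len (v \<circ> adj i) = len (v \<circ> adj i \<circ> adj k) + 1"
      using True vk vi v i k by (intro len_adj_descent) (simp_all add: adj_def transpose_def)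
    moreover have "len v = len (v \<circ> adj i) + 1" using vi v i by (intro len_adj_descent) simp_all
    ultimately have l: "len u = len u' + 3" using len_inv[OF u] by (simp add: v_def)
    have "reduced_word ([i, k, i] @ c) u" "reduced_word ([k, i, k] @ c) u"
      using reduced_word_append[OF c, of "[i, k, i]"] reduced_word_append[OF c, of "[k, i, k]"] i k l com
      by (simp_all add: comp_assoc)
    then have "divdiff_word (i # a) P = divdiff_word (i # k # i # c) P"
      "divdiff_word (k # b) P = divdiff_word (k # i # k # c) P"
      using transfer transfer' by simp_all
    then show ?thesis using divdiff_braid[of i "divdiff_word c P"] True by simp
  qed
qed

lemma divdiff_word_eq:
  "reduced_word a u \<Longrightarrow> reduced_word b u \<Longrightarrow> divdiff_word a P = divdiff_word b P"
proof (induction "length a" arbitrary: a b u)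
  case 0
  then have "a = b" by (metis length_0_conv reduced_word_def)
  then show ?case by simp
next
  case (Suc n)
  have "length b = Suc n" using Suc by (simp add: reduced_word_def)
  then obtain i a' k b' where ab: "a = i # a'" "b = k # b'" and n: "length a' = n" "length b' = n"
    using Suc.hyps(2) by (metis Suc_length_conv)
  note red = Suc.prems[unfolded ab]
  have IH: "divdiff_word a P = divdiff_word b P"
    if "reduced_word a u" "reduced_word b u" "length a = n" for a b u
    using Suc.hyps(1) that by blast
  consider "i = k" | "i < k" | "k < i" by linarith
  then show ?case
  proof cases
    case 1
    then have "divdiff_word a' P = divdiff_word b' P"
      using IH red reduced_word_Cons_D(2) n by blast
    then show ?thesis using ab 1 by simp
  next
    case 2
    then show ?thesis unfolding ab using divdiff_word_eq_distinct_heads IH red n by blast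
  next
    case 3
    then show ?thesis
      unfolding ab using divdiff_word_eq_distinct_heads[OF _ red(2) red(1) n(2), symmetric] IH by blast
  qed
qed

lemma divdiff_perm_eq: "reduced_word ws u \<Longrightarrow> divdiff_perm u P = divdiff_word ws P"
  unfolding divdiff_perm_def by (rule divdiff_word_eq) (rule someI)

lemma divdiff_perm_id [simp]: "divdiff_perm id P = P"
  using divdiff_perm_eq[of "[]" id] by (simp add: reduced_word_def)

lemma divdiff_perm_adj:
  assumes "u \<in> S_infty" "1 \<le> i" "len (adj i \<circ> u) = len u + 1"
  shows "divdiff_perm (adj i \<circ> u) P = divdiff i (divdiff_perm u P)"
proof -
  obtain ws where ws: "reduced_word ws u" using exists_reduced_word[OF assms(1)] by blast
  then have "reduced_word (i # ws) (adj i \<circ> u)"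
    using reduced_word_append[OF ws, of "[i]"] assms by simp
  then show ?thesis using ws by (simp add: divdiff_perm_eq)
qed

section \<open>Double Schubert polynomials\<close>

subsection \<open>Codes\<close>

lemma finite_code_set:
  assumes "u \<in> S_infty" "1 \<le> i"
  shows "finite {j. i < j \<and> u j < u i}"
proof -
  have "{j. i < j \<and> u j < u i} \<subseteq> snd ` inversions u"
    using assms by (force simp: inversions_def)
  then show ?thesis using finite_inversions[OF assms(1)] finite_surj by blast
qed

lemma lehmer_code_adj_other:
  assumes "k \<noteq> i" "k \<noteq> Suc i"
  shows "lehmer_code (u \<circ> adj i) k = lehmer_code u k"
proof -
  have "bij_betw (adj i) {j. k < j \<and> (u \<circ> adj i) j < (u \<circ> adj i) k} {j. k < j \<and> u j < u k}"
    using assms by (intro bij_betw_byWitness[of _ "adj i"]) (auto simp: adj_def transpose_def)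
  then show ?thesis unfolding lehmer_code_def by (rule bij_betw_same_card)
qed

text \<open>The two entries follow their values. The larger value, now on the left, also counts the
  smaller one.\<close>

lemma lehmer_code_adj:
  assumes u: "u \<in> S_infty" "1 \<le> i" and asc: "u i < u (Suc i)"
  shows "lehmer_code (u \<circ> adj i) i = lehmer_code u (Suc i) + 1"
    and "lehmer_code (u \<circ> adj i) (Suc i) = lehmer_code u i"
proof -
  have "{j. i < j \<and> (u \<circ> adj i) j < (u \<circ> adj i) i} = insert (Suc i) {j. Suc i < j \<and> u j < u (Suc i)}"
    using asc by (auto simp: adj_def transpose_def)
  then show "lehmer_code (u \<circ> adj i) i = lehmer_code u (Suc i) + 1"
    using finite_code_set[OF u(1), of "Suc i"] unfolding lehmer_code_def by simp
  have "{j. Suc i < j \<and> (u \<circ> adj i) j < (u \<circ> adj i) (Suc i)} = {j. i < j \<and> u j < u i}"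
    using asc by (auto simp: adj_def transpose_def)
  then show "lehmer_code (u \<circ> adj i) (Suc i) = lehmer_code u i"
    unfolding lehmer_code_def by simp
qed

lemma lehmer_code_ascent:
  assumes u: "u \<in> S_infty" and asc: "u i < u (Suc i)"
  shows "lehmer_code u i \<le> lehmer_code u (Suc i)"
  unfolding lehmer_code_def
  using asc by (intro card_mono finite_code_set[OF u]) (auto, metis Suc_lessI less_asym)

lemma lehmer_code_descent:
  assumes u: "u \<in> S_infty" "1 \<le> i" and desc: "u (Suc i) < u i"
  shows "lehmer_code u (Suc i) < lehmer_code u i"
proof -
  have "lehmer_code (u \<circ> adj i \<circ> adj i) i = lehmer_code (u \<circ> adj i) (Suc i) + 1"
    "lehmer_code (u \<circ> adj i \<circ> adj i) (Suc i) = lehmer_code (u \<circ> adj i) i"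
    using lehmer_code_adj[of "u \<circ> adj i" i] u desc by simp_all
  moreover have "lehmer_code (u \<circ> adj i) i \<le> lehmer_code (u \<circ> adj i) (Suc i)"
    using u desc by (intro lehmer_code_ascent) simp_all
  ultimately show ?thesis by simp
qed

lemma lehmer_code_w0: "1 \<le> i \<Longrightarrow> i \<le> n + 1 \<Longrightarrow> lehmer_code (w0 n) i = n + 1 - i"
proof -
  assume "1 \<le> i" "i \<le> n + 1"
  then have "{j. i < j \<and> w0 n j < w0 n i} = {i<..n + 1}" by (auto simp: w0_def)
  then show ?thesis by (simp add: lehmer_code_def)
qed

lemma dominant_w0: "dominant (w0 n)"
  unfolding dominant_def
proof (intro allI impI)
  fix i :: nat assume i: "1 \<le> i"
  show "lehmer_code (w0 n) (i + 1) \<le> lehmer_code (w0 n) i"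
  proof (cases "i + 1 \<le> n + 1")
    case True
    then show ?thesis using i by (simp add: lehmer_code_w0)
  next
    case False
    then show ?thesis using permutes_lehmer_code_0[OF w0_permutes, of n "i + 1"] by simp
  qed
qed

subsection \<open>Stability and divided differences\<close>

text \<open>Keeps \<open>n\<close> as a parameter, so that inductions can run inside a fixed
  symmetric group; \<open>schub_stable\<close> removes the dependence.\<close>

definition schub :: "nat \<Rightarrow> (nat \<Rightarrow> nat) \<Rightarrow> mpoly" where
  "schub n u = divdiff_perm (inv u \<circ> w0 n) (schubert_w0 n)"

lemma schub_w0: "schub n (w0 n) = schubert_w0 n"
  by (simp add: schub_def)

text \<open>\<open>w0 n\<close> reverses the order of values, so an ascent of \<open>u\<close> at
  \<open>i\<close> means that \<open>adj i\<close> is a length-increasing left factor of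
  \<open>inv u \<circ> w0 n\<close>.\<close>

lemma schub_ascent:
  assumes u: "u permutes {1..n + 1}" and i: "1 \<le> i" "i \<le> n" and asc: "u i < u (Suc i)"
  shows "schub n u = divdiff i (schub n (u \<circ> adj i))"
proof -
  note S = S_inftyI[OF u] S_inftyI[OF w0_permutes, of n]
  let ?g = "inv (u \<circ> adj i) \<circ> w0 n"
  have g: "?g \<in> S_infty" using S i by simp
  have eq: "inv u \<circ> w0 n = adj i \<circ> ?g"
    using S_infty_bij[OF S(1)] by (simp add: o_inv_distrib comp_assoc[symmetric])
  have inv_g: "inv ?g = w0 n \<circ> (u \<circ> adj i)"
    using S_infty_bij[of "u \<circ> adj i"] S_infty_bij[of "inv (u \<circ> adj i)"] S_infty_bij[OF S(2)] S i
    by (simp add: o_inv_distrib S_infty_inv_comp)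
  have "u i \<in> {1..n + 1}" "u (Suc i) \<in> {1..n + 1}"
    using permutes_in_image[OF u, of i] permutes_in_image[OF u, of "Suc i"] i by auto
  then have "inv ?g i < inv ?g (Suc i)" using asc by (simp add: inv_g w0_def)
  then have "len (adj i \<circ> ?g) = len ?g + 1"
    using len_adj[of "inv ?g" i] g i len_adj_left[OF g] len_inv[OF g] by simp
  then show ?thesis using divdiff_perm_adj[OF g i(1)] by (simp add: schub_def eq)
qed

text \<open>For dominant \<open>u\<close>, the product over the boxes of the Young diagram whose
  rows are the code, with \<open>i\<close> the row and \<open>j\<close> the column.\<close>

definition code_poly :: "nat \<Rightarrow> (nat \<Rightarrow> nat) \<Rightarrow> mpoly" where
  "code_poly n u = (\<Prod>i\<in>{1..n + 1}. \<Prod>j\<in>{1..lehmer_code u i}. X i - Y j)"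

lemma code_poly_w0: "code_poly n (w0 n) = schubert_w0 n"
proof -
  have "code_poly n (w0 n) = (\<Prod>(i, j)\<in>Sigma {1..n + 1} (\<lambda>i. {1..lehmer_code (w0 n) i}). X i - Y j)"
    unfolding code_poly_def by (rule prod.Sigma) auto
  also have "Sigma {1..n + 1} (\<lambda>i. {1..lehmer_code (w0 n) i}) = {(i, j). 1 \<le> i \<and> 1 \<le> j \<and> i + j \<le> n + 1}"
    by (auto simp: lehmer_code_w0 lehmer_code_w0[unfolded One_nat_def])
  finally show ?thesis by (simp add: schubert_w0_def)
qed

text \<open>
  At the first ascent \<open>i\<close> of a dominant permutation the code is constant, so the product is
  symmetric in \<open>x\<^sub>i\<close> and \<open>x\<^sub>i\<^sub>+\<^sub>1\<close>; passing to \<open>u \<circ> adj i\<close> adds one box to row \<open>i\<close>, and the divided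
  difference removes it again.
\<close>

lemma schub_dominant:
  assumes "u permutes {1..n + 1}" "dominant u"
  shows "schub n u = code_poly n u"
  using assms
proof (induction "(n + 1) * (n + 1) - len u" arbitrary: u rule: less_induct)
  case less
  note u = less.prems(1)
  note S = S_inftyI[OF u]
  show ?case
  proof (cases "u = w0 n")
    case True
    then show ?thesis by (simp add: schub_w0 code_poly_w0)
  next
    case False
    define A where "A i \<longleftrightarrow> 1 \<le> i \<and> i \<le> n \<and> u i < u (Suc i)" for i
    \<comment> \<open>The first ascent is taken because \<open>i - 1\<close> is then a descent if
      \<open>i > 1\<close>. The code drops strictly there, so row \<open>i\<close> can grow by one
      box without destroying dominance.\<close>
    define i where "i = (LEAST i. A i)"
    have "\<exists>i. A i" using eq_w0_or_ascent[OF u] False unfolding A_def by metis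
    then have i: "A i" unfolding i_def by (rule LeastI_ex)
    have minimal: "\<not> A k" if "k < i" for k using that not_less_Least unfolding i_def by blast
    have i1: "1 \<le> i" "i \<le> n" and asc: "u i < u (Suc i)" using i by (auto simp: A_def)
    let ?u = "u \<circ> adj i"
    have const: "lehmer_code u (Suc i) = lehmer_code u i"
      using lehmer_code_ascent[OF S asc] less.prems(2) i1 unfolding dominant_def
      by (metis Suc_eq_plus1 le_antisym)
    have code: "lehmer_code ?u k = (if k = i then lehmer_code u i + 1 else lehmer_code u k)" for k
      using lehmer_code_adj[OF S i1(1) asc] lehmer_code_adj_other[of k i u] const
      by (cases "k = Suc i") auto
    have dom: "dominant ?u"
      unfolding dominant_def
    proof (intro allI impI)
      fix k :: nat assume k: "1 \<le> k"
      have le: "lehmer_code u (k + 1) \<le> lehmer_code u k" using less.prems(2) k by (simp add: dominant_def)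
      show "lehmer_code ?u (k + 1) \<le> lehmer_code ?u k"
      proof (cases "k + 1 = i")
        case True
        then have "\<not> u k < u (Suc k)" using minimal[of k] k i1 by (auto simp: A_def)
        then have "u (Suc k) < u k" using S_infty_inj[OF S, of k "Suc k"] by (meson n_not_Suc_n nat_neq_iff)
        then show ?thesis using lehmer_code_descent[OF S k] True by (simp add: code)
      next
        case False
        then show ?thesis using le const by (simp add: code)
      qed
    qed
    have p: "?u permutes {1..n + 1}" using permutes_comp_adj[OF u] i1 by simp
    have "len u < len ?u" using len_adj[OF S] i1 asc by simp
    moreover have "len ?u \<le> (n + 1) * (n + 1)" using len_le_square[OF p] .
    ultimately have "(n + 1) * (n + 1) - len ?u < (n + 1) * (n + 1) - len u" by linarith
    then have "schub n ?u = code_poly n ?u" using less.hyps p dom by blast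
    also have "code_poly n ?u = (X i - Y (lehmer_code u i + 1)) * code_poly n u"
    proof -
      have "i \<in> {1..n + 1}" using i1 by simp
      then have "code_poly n ?u = (\<Prod>j\<in>{1..lehmer_code u i + 1}. X i - Y j) *
          (\<Prod>k\<in>{1..n + 1} - {i}. \<Prod>j\<in>{1..lehmer_code u k}. X k - Y j)"
        unfolding code_poly_def by (subst prod.remove[of _ i]) (auto simp: code)
      also have "\<dots> = (X i - Y (lehmer_code u i + 1)) * code_poly n u"
        unfolding code_poly_def using \<open>i \<in> {1..n + 1}\<close>
        by (subst prod.remove[of "{1..n + 1}" i]) (simp_all add: mult_ac)
      finally show ?thesis .
    qed
    finally have "schub n u = divdiff i (code_poly n u * (X i - Y (lehmer_code u i + 1)))"
      using schub_ascent[OF u i1 asc] by (simp add: mult.commute)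
    moreover have "act i (code_poly n u) = code_poly n u"
    proof -
      have "lehmer_code u (adj i k) = lehmer_code u k" for k
        using const by (auto simp: adj_def transpose_def)
      then show ?thesis
        unfolding code_poly_def act_hom act_X act_Y
      proof (intro prod.reindex_bij_witness[of "{1..n + 1}" "adj i" "adj i"])
        fix k assume "k \<in> {1..n + 1}"
        then show "adj i k \<in> {1..n + 1}" "adj i k \<in> {1..n + 1}"
          using i1 by (auto simp: adj_def transpose_def)
      qed simp_all
    qed
    moreover have "divdiff i (X i - Y (lehmer_code u i + 1)) = 1"
      by (rule divdiff_eqI) (simp add: act_hom)
    ultimately show ?thesis by (simp add: divdiff_mult_left)
  qed
qed

text \<open>For \<open>w0 n\<close> both sides are the product of \<open>schub_dominant\<close>, as
  \<open>w0 n\<close> is dominant also in the larger group. Below it, the same divided differences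
  are applied on both sides.\<close>

lemma schub_stable:
  assumes u: "u permutes {1..n + 1}" and mn: "n \<le> m"
  shows "schub m u = schub n u"
  using u order_refl[of n]
proof (induction rule: ascent_induct[of u n n])
  case (stop u)
  then have "u = w0 n" using eq_w0_or_ascent by blast
  moreover have "code_poly m (w0 n) = code_poly n (w0 n)"
    unfolding code_poly_def using mn permutes_lehmer_code_0[OF w0_permutes]
    by (intro prod.mono_neutral_right) auto
  ultimately show ?case
    using schub_dominant dominant_w0 w0_permutes permutes_mono[OF w0_permutes, of n "m + 1"] mn
    by simp
next
  case (ascent u i)
  then show ?case
    using schub_ascent[of u n i] schub_ascent[of u m i] permutes_mono[of u "n + 1" "m + 1"] mn
    by (simp add: comp_def)
qed simp

lemma schubert_xy_eq_schub:
  assumes "u permutes {1..n + 1}"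
  shows "schubert_xy u = schub n u"
proof -
  define k where "k = (LEAST n. u permutes {1..n + 1})"
  have "u permutes {1..k + 1}" unfolding k_def using assms by (rule LeastI)
  moreover have "k \<le> n" unfolding k_def using assms by (rule Least_le)
  moreover have "schubert_xy u = schub k u" by (simp add: schubert_xy_def schub_def k_def Let_def)
  ultimately show ?thesis using schub_stable[of u k n] by simp
qed

lemma divdiff_schubert_descent:
  assumes u: "u \<in> S_infty" "1 \<le> i" and desc: "u (Suc i) < u i"
  shows "divdiff i (schubert_xy u) = schubert_xy (u \<circ> adj i)"
proof -
  obtain n where n: "i \<le> n" "u permutes {1..n + 1}" using S_infty_permutes_above[OF u(1)] .
  then have p: "u \<circ> adj i permutes {1..n + 1}" using permutes_comp_adj u by simp
  have "schub n (u \<circ> adj i) = divdiff i (schub n (u \<circ> adj i \<circ> adj i))"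
    using p u n desc by (intro schub_ascent) simp_all
  then show ?thesis using schubert_xy_eq_schub n p by simp
qed

text \<open>At an ascent the polynomial is itself a value of \<open>divdiff i\<close>, and this
  operator squares to zero.\<close>

lemma divdiff_schubert_ascent:
  assumes u: "u \<in> S_infty" "1 \<le> i" and asc: "u i < u (Suc i)"
  shows "divdiff i (schubert_xy u) = 0"
proof -
  have "schubert_xy u = divdiff i (schubert_xy (u \<circ> adj i))"
    using divdiff_schubert_descent[of "u \<circ> adj i" i] assms by simp
  then show ?thesis by (simp only: divdiff_divdiff)
qed

lemma schubert_dominant:
  "u permutes {1..n + 1} \<Longrightarrow> dominant u \<Longrightarrow> schubert_xy u = code_poly n u"
  by (simp add: schubert_xy_eq_schub schub_dominant)

subsection \<open>Monk's formula\<close>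

text \<open>The sign of the transposition of \<open>a\<close> and \<open>b\<close> in Monk's formula
  for multiplication by \<open>x_a\<close>.\<close>

definition transp_sign :: "nat \<Rightarrow> nat \<Rightarrow> mpoly" where
  "transp_sign a b = (if a < b then 1 else -1)"

lemma act_transp_sign [simp]: "act k (transp_sign a b) = transp_sign a b"
  using act_of_int[of k "-1"] by (simp add: transp_sign_def)

text \<open>Inside \<open>{1..n + 1}\<close> every transposition shortens \<open>w0 n\<close>, so
  only the first fixed point \<open>n + 2\<close> can be used.\<close>

lemma covers_w0_iff:
  assumes i: "1 \<le> i" "i \<le> n + 1"
  shows "covers (w0 n) i b \<longleftrightarrow> b = n + 2"
proof
  assume cov: "covers (w0 n) i b"
  have "b \<le> n + 2" using covers_bounded[OF w0_permutes _ cov] i by simp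
  moreover have "\<not> b \<le> n + 1"
  proof
    assume b: "b \<le> n + 1"
    have "1 \<le> b" "b \<noteq> i" using cov by (auto simp: covers_def)
    then show False
      using covers_less[OF S_inftyI[OF w0_permutes] cov] i b
        covers_less[OF S_inftyI[OF w0_permutes], of n b i] cov covers_commute
      by (cases "i < b") (auto simp: w0_def)
  qed
  ultimately show "b = n + 2" by simp
next
  assume "b = n + 2"
  then show "covers (w0 n) i b"
    using i by (intro coversI S_inftyI[OF w0_permutes]) (auto simp: w0_def)
qed

text \<open>The transposition adds a single box to row \<open>i\<close> of the staircase. The result
  is still dominant, and the new box lies in column \<open>n + 2 - i\<close>, which is
  \<open>w0 n i\<close>.\<close>

lemma schubert_w0_transpose:
  assumes i: "1 \<le> i" "i \<le> n + 1"
  shows "schubert_xy (w0 n \<circ> transpose i (n + 2)) = (X i - Y (w0 n i)) * schubert_xy (w0 n)"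
proof -
  define u where "u = w0 n \<circ> transpose i (n + 2)"
  have "transpose i (n + 2) permutes {1..n + 1 + 1}" using i by (intro permutes_swap_id) auto
  then have p: "u permutes {1..n + 1 + 1}"
    unfolding u_def by (rule permutes_compose) (rule permutes_mono[OF w0_permutes], simp)
  have p0: "w0 n permutes {1..n + 1 + 1}" by (rule permutes_mono[OF w0_permutes]) simp
  have code: "lehmer_code u k = lehmer_code (w0 n) k + (if k = i then 1 else 0)" if "1 \<le> k" for k
  proof -
    consider "k < i" | "k = i" | "i < k" "k \<le> n + 1" | "n + 2 \<le> k" by linarith
    then show ?thesis
    proof cases
      case 1
      \<comment> \<open>Position \<open>i\<close> leaves the count, its value now being
        \<open>n + 2\<close>, and position \<open>n + 2\<close> enters it.\<close>
      then have "{j. k < j \<and> u j < u k} = {k<..n + 2} - {i}"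
        using i that by (auto simp: u_def w0_def transpose_def)
      then have "lehmer_code u k = n + 1 - k" using 1 i by (simp add: lehmer_code_def)
      then show ?thesis using 1 i that by (simp add: lehmer_code_w0)
    next
      case 2
      then have "{j. k < j \<and> u j < u k} = {k<..n + 2}"
        using i that by (auto simp: u_def w0_def transpose_def)
      then have "lehmer_code u k = n + 2 - k"
        by (simp only: lehmer_code_def card_greaterThanAtMost)
      then show ?thesis using 2 i by (simp add: lehmer_code_w0)
    next
      case 3
      then have "{j. k < j \<and> u j < u k} = {k<..n + 1}"
        using i that by (auto simp: u_def w0_def transpose_def)
      then have "lehmer_code u k = n + 1 - k"
        by (simp only: lehmer_code_def card_greaterThanAtMost)
      then show ?thesis using 3 i that by (simp add: lehmer_code_w0)
    next
      case 4
      then show ?thesis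
        using permutes_lehmer_code_0[OF p, of k] permutes_lehmer_code_0[OF p0, of k] i by simp
    qed
  qed
  have "dominant u"
    unfolding dominant_def
  proof (intro allI impI)
    fix k :: nat assume k: "1 \<le> k"
    show "lehmer_code u (k + 1) \<le> lehmer_code u k"
    proof (cases "k + 1 = i")
      case True
      then show ?thesis using k i by (simp add: code lehmer_code_w0)
    next
      case False
      then show ?thesis using k dominant_w0[of n] by (auto simp: code dominant_def)
    qed
  qed
  then have "schubert_xy u = code_poly (n + 1) u" using p by (rule schubert_dominant[rotated])
  also have "\<dots> = (\<Prod>j\<in>{1..lehmer_code (w0 n) i + 1}. X i - Y j) *
      (\<Prod>k\<in>{1..n + 1 + 1} - {i}. \<Prod>j\<in>{1..lehmer_code (w0 n) k}. X k - Y j)"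
    unfolding code_poly_def using i by (subst prod.remove[of _ i]) (auto simp: code)
  also have "\<dots> = (X i - Y (lehmer_code (w0 n) i + 1)) * code_poly (n + 1) (w0 n)"
    unfolding code_poly_def using i
    by (subst prod.remove[of "{1..n + 1 + 1}" i]) (simp_all add: mult_ac)
  also have "code_poly (n + 1) (w0 n) = schubert_xy (w0 n)"
    using p0 dominant_w0 by (rule schubert_dominant[symmetric])
  also have "lehmer_code (w0 n) i + 1 = w0 n i"
    using i by (simp add: lehmer_code_w0 w0_def)
  finally show ?thesis unfolding u_def .
qed

lemma len_transpose_less_iff_unordered:
  assumes "u \<in> S_infty" "1 \<le> a" "1 \<le> b" "a \<noteq> b"
  shows "len u < len (u \<circ> transpose a b) \<longleftrightarrow> (a < b \<longleftrightarrow> u a < u b)"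
proof (cases "a < b")
  case True
  then show ?thesis using len_transpose_less_iff assms by simp
next
  case False
  then show ?thesis
    using len_transpose_less_iff[of u b a] assms S_infty_inj[OF assms(1), of a b]
    by (auto simp: transpose_commute)
qed

text \<open>Both \<open>u\<close> and \<open>u \<circ> transpose i b\<close> are compared with their
  products with \<open>adj k\<close>: the lengths match exactly if the latter also has an ascent at
  \<open>k\<close>. The excluded pair consists of \<open>k\<close> and \<open>Suc k\<close>, the
  only positions whose order \<open>adj k\<close> reverses.\<close>

lemma covers_adj_iff:
  assumes u: "u \<in> S_infty" and k: "1 \<le> k" "u k < u (Suc k)" and ib: "b \<noteq> i" "b \<noteq> adj k i"
  shows "covers u i b \<longleftrightarrow> covers (u \<circ> adj k) (adj k i) (adj k b) \<and>
    (u \<circ> transpose i b) k < (u \<circ> transpose i b) (Suc k)"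
    and "u \<circ> adj k \<circ> transpose (adj k i) (adj k b) = u \<circ> transpose i b \<circ> adj k"
proof -
  let ?v = "u \<circ> adj k" and ?t = "transpose i b" and ?t' = "transpose (adj k i) (adj k b)"
  show eq: "?v \<circ> ?t' = u \<circ> ?t \<circ> adj k"
    using ib by (auto simp: fun_eq_iff adj_def transpose_def)
  have pos: "1 \<le> adj k x \<longleftrightarrow> 1 \<le> x" for x using k by (auto simp: adj_def transpose_def)
  have ne: "adj k i \<noteq> adj k b" using ib by (metis adj_simps(4))
  have v: "?v \<in> S_infty" using u k by simp
  have lv: "len ?v = len u + 1" using len_adj[OF u k] .
  have order: "adj k i < adj k b \<longleftrightarrow> i < b" using ib by (auto simp: adj_def transpose_def)
  show "covers u i b \<longleftrightarrow> covers ?v (adj k i) (adj k b) \<and> (u \<circ> ?t) k < (u \<circ> ?t) (Suc k)"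
  proof
    assume cov: "covers u i b"
    then have p: "1 \<le> i" "1 \<le> b" by (auto simp: covers_def)
    have ut: "u \<circ> ?t \<in> S_infty" using u p by simp
    have "len u < len (u \<circ> ?t)" using cov by (simp add: covers_def)
    then have "i < b \<longleftrightarrow> u i < u b" using len_transpose_less_iff_unordered[OF u] p ib by simp
    then have "len ?v < len (?v \<circ> ?t')"
      using len_transpose_less_iff_unordered[OF v] p pos ne order by simp
    then have "len ?v < len (u \<circ> ?t \<circ> adj k)" by (simp only: eq)
    moreover have "len (u \<circ> ?t \<circ> adj k) \<le> len (u \<circ> ?t) + 1" using len_adj_bounds(1)[OF ut k(1)] .
    moreover have lt: "len (u \<circ> ?t) = len u + 1" using cov by (simp add: covers_def)
    ultimately have l: "len (u \<circ> ?t \<circ> adj k) = len ?v + 1" using lv by linarith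
    then have "len (u \<circ> ?t) < len (u \<circ> ?t \<circ> adj k)" using lt lv by linarith
    then have "(u \<circ> ?t) k < (u \<circ> ?t) (Suc k)" using len_adj_less_iff[OF ut k(1)] by blast
    moreover have "covers ?v (adj k i) (adj k b)"
      using l p pos ne unfolding covers_def eq by blast
    ultimately show "covers ?v (adj k i) (adj k b) \<and> (u \<circ> ?t) k < (u \<circ> ?t) (Suc k)" by blast
  next
    assume R: "covers ?v (adj k i) (adj k b) \<and> (u \<circ> ?t) k < (u \<circ> ?t) (Suc k)"
    then have p: "1 \<le> i" "1 \<le> b" using pos by (auto simp: covers_def)
    have ut: "u \<circ> ?t \<in> S_infty" using u p by simp
    have "len (u \<circ> ?t \<circ> adj k) = len ?v + 1"
      using R unfolding covers_def eq by blast
    moreover have "len (u \<circ> ?t \<circ> adj k) = len (u \<circ> ?t) + 1"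
      using len_adj[OF ut k(1)] R by blast
    ultimately have "len (u \<circ> ?t) = len u + 1" using lv by linarith
    then show "covers u i b" using p ib unfolding covers_def by blast
  qed
qed

definition monk :: "nat \<Rightarrow> (nat \<Rightarrow> nat) \<Rightarrow> bool" where
  "monk i u \<longleftrightarrow> X i * schubert_xy u = Y (u i) * schubert_xy u +
    (\<Sum>b\<in>{b. covers u i b}. transp_sign i b * schubert_xy (u \<circ> transpose i b))"

lemma monk_w0:
  assumes "1 \<le> i" "i \<le> n + 1"
  shows "monk i (w0 n)"
proof -
  have "{b. covers (w0 n) i b} = {n + 2}" using covers_w0_iff[OF assms] by blast
  then show ?thesis
    unfolding monk_def using schubert_w0_transpose[OF assms] assms
    by (simp add: transp_sign_def algebra_simps)
qed

lemma divdiff_schubert: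
  assumes "w \<in> S_infty" "1 \<le> k"
  shows "divdiff k (schubert_xy w) = (if w (Suc k) < w k then schubert_xy (w \<circ> adj k) else 0)"
proof (rule ascent_or_descent[OF assms(1), of k])
  assume "w k < w (Suc k)"
  then show ?thesis using divdiff_schubert_ascent[OF assms] by simp
qed (simp add: divdiff_schubert_descent[OF assms])

text \<open>Applies \<open>divdiff k\<close> to Monk's formula for \<open>u \<circ> adj k\<close>.
  By \<open>covers_adj_iff\<close> the surviving terms are the covers of \<open>u\<close>, except
  for a possible one at \<open>adj k i\<close>, which comes from the Leibniz rule on the left-hand
  side.\<close>

lemma monk_adj:
  assumes u: "u \<in> S_infty" and k: "1 \<le> k" "u k < u (Suc k)" and i: "1 \<le> i"
    and monk: "monk (adj k i) (u \<circ> adj k)"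
  shows "monk i u"
proof -
  let ?v = "u \<circ> adj k" and ?j = "adj k i"
  let ?C = "{b. covers u i b}" and ?D = "{b. covers ?v ?j b}"
  let ?f = "\<lambda>b. transp_sign i b * schubert_xy (u \<circ> transpose i b)"
  have v: "?v \<in> S_infty" using u k by simp
  have j: "1 \<le> ?j" using i k by (auto simp: adj_def transpose_def)
  have dv: "divdiff k (schubert_xy ?v) = schubert_xy u"
    using divdiff_schubert_descent[OF v k(1)] k by simp
  \<comment> \<open>If the two positions differ, the transposition is \<open>adj k\<close>, which
    leads from \<open>?v\<close> back down to \<open>u\<close>.\<close>
  have notj: "\<not> covers ?v ?j i"
  proof (cases "?j = i")
    case True
    then show ?thesis by (simp add: covers_def)
  next
    case False
    then have "transpose ?j i = adj k" by (auto simp: adj_def transpose_def fun_eq_iff split: if_splits)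
    then show ?thesis using len_adj[OF u k] by (simp add: covers_def)
  qed
  have D: "?D = adj k ` {b. covers ?v ?j (adj k b)}"
    by (auto simp: image_iff) (metis adj_simps(4))
  have "divdiff k (\<Sum>b\<in>?D. transp_sign ?j b * schubert_xy (?v \<circ> transpose ?j b)) =
      (\<Sum>b\<in>{b. covers ?v ?j (adj k b)}.
        transp_sign ?j (adj k b) * divdiff k (schubert_xy (?v \<circ> transpose ?j (adj k b))))"
  proof -
    have inj: "inj_on (adj k) A" for A by (metis adj_simps(4) inj_onI)
    show ?thesis by (subst D) (simp add: divdiff_sum divdiff_mult_left sum.reindex[OF inj])
  qed
  also have "\<dots> = (\<Sum>b\<in>{b. covers ?v ?j (adj k b)}.
      if covers u i b then ?f b else 0)"
  proof (rule sum.cong[OF refl])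
    fix b assume "b \<in> {b. covers ?v ?j (adj k b)}"
    then have b: "covers ?v ?j (adj k b)" by simp
    then have ib: "b \<noteq> i" "b \<noteq> adj k i" using notj by (auto simp: covers_def)
    have pb: "1 \<le> b" using b k by (auto simp: covers_def adj_def transpose_def split: if_splits)
    note c = covers_adj_iff[OF u k ib]
    have sgn: "transp_sign ?j (adj k b) = transp_sign i b"
      using ib by (auto simp: transp_sign_def adj_def transpose_def)
    have "u \<circ> transpose i b \<circ> adj k \<in> S_infty" using u i pb k by simp
    then have "divdiff k (schubert_xy (u \<circ> transpose i b \<circ> adj k)) =
        (if (u \<circ> transpose i b \<circ> adj k) (Suc k) < (u \<circ> transpose i b \<circ> adj k) k
         then schubert_xy (u \<circ> transpose i b \<circ> adj k \<circ> adj k) else 0)"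
      using divdiff_schubert[OF _ k(1)] by blast
    then have "divdiff k (schubert_xy (u \<circ> transpose i b \<circ> adj k)) =
        (if covers u i b then schubert_xy (u \<circ> transpose i b) else 0)"
      using b c(1) by simp
    then show "transp_sign ?j (adj k b) * divdiff k (schubert_xy (?v \<circ> transpose ?j (adj k b))) =
        (if covers u i b then ?f b else 0)"
      unfolding c(2) sgn by simp
  qed
  also have "\<dots> = (\<Sum>b\<in>?C - {?j}. ?f b)"
  proof (rule sum.mono_neutral_cong)
    have "finite (adj k ` ?D)" using finite_covers[OF v] by simp
    moreover have "{b. covers ?v ?j (adj k b)} \<subseteq> adj k ` ?D"
      by (auto simp: image_iff) (metis adj_simps(4))
    ultimately show "finite {b. covers ?v ?j (adj k b)}" using finite_subset by blast
    show "finite (?C - {?j})" using finite_covers[OF u] by simp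
    show "(if covers u i b then ?f b else 0) = 0"
      if "b \<in> {b. covers ?v ?j (adj k b)} - (?C - {?j})" for b
      using that notj by auto
    show "?f b = 0" if "b \<in> (?C - {?j}) - {b. covers ?v ?j (adj k b)}" for b
      using that covers_adj_iff(1)[OF u k, of b i] by (auto simp: covers_def[of u])
  qed auto
  finally have R: "divdiff k (\<Sum>b\<in>?D. transp_sign ?j b * schubert_xy (?v \<circ> transpose ?j b)) =
      (\<Sum>b\<in>?C - {?j}. ?f b)" .
  have Yj: "act k (Y (u i)) = Y (u i)" by simp
  have "divdiff k (X ?j * schubert_xy ?v) = Y (u i) * schubert_xy u + (\<Sum>b\<in>?C - {?j}. ?f b)"
    using monk[unfolded monk_def] by (simp add: divdiff_add divdiff_mult_left[OF Yj] dv R)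
  \<comment> \<open>The Leibniz term is the Schubert polynomial of \<open>?v\<close>, that is, of
    the cover of \<open>u\<close> by \<open>adj k\<close>; its sign depends on whether
    \<open>i\<close> is the left or the right position.\<close>
  moreover have "divdiff k (X ?j * schubert_xy ?v) =
      X i * schubert_xy u - (if ?j \<in> ?C then ?f ?j else 0)"
  proof -
    have t: "transpose k (Suc k) = adj k" "transpose (Suc k) k = adj k"
      by (simp_all add: adj_def transpose_commute)
    consider "i = k" | "i = Suc k" | "i \<noteq> k" "i \<noteq> Suc k" by blast
    then show ?thesis
    proof cases
      case 1
      then have "covers u i ?j" using len_adj[OF u k] k by (simp add: covers_def t)
      then show ?thesis
        using 1 by (simp add: divdiff_X_Suc_mult dv transp_sign_def t)
    next
      case 2
      then have "covers u i ?j"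
        using len_adj[OF u k] k by (simp add: covers_def t)
      then show ?thesis
        using 2 by (simp add: divdiff_X_mult dv transp_sign_def t)
    next
      case 3
      then have "\<not> covers u i ?j" by (simp add: covers_def)
      moreover have "act k (X i) = X i" using 3 by simp
      ultimately show ?thesis using 3 by (simp add: divdiff_mult_left dv)
    qed
  qed
  moreover have "(\<Sum>b\<in>?C. ?f b) = (if ?j \<in> ?C then ?f ?j else 0) + (\<Sum>b\<in>?C - {?j}. ?f b)"
    using finite_covers[OF u] by (simp add: sum.remove)
  ultimately show ?thesis unfolding monk_def by (simp only:) (simp add: algebra_simps)
qed

theorem monk_formula:
  assumes "u \<in> S_infty" "1 \<le> i"
  shows "X i * schubert_xy u = Y (u i) * schubert_xy u +
    (\<Sum>b\<in>{b. covers u i b}. transp_sign i b * schubert_xy (u \<circ> transpose i b))"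
proof -
  obtain n where n: "i \<le> n" "u permutes {1..n + 1}" using S_infty_permutes_above[OF assms(1)] .
  \<comment> \<open>All positions are treated at once, since the induction step moves
    \<open>i\<close> to \<open>adj k i\<close>.\<close>
  have "\<forall>i\<in>{1..n + 1}. monk i u"
    using n(2) order_refl[of n]
  proof (induction rule: ascent_induct[of u n n])
    case (stop u)
    then have "u = w0 n" using eq_w0_or_ascent by blast
    then show ?case using monk_w0 by simp
  next
    case (ascent u k)
    have "adj k i \<in> {1..n + 1}" if "i \<in> {1..n + 1}" for i
      using that ascent(2,3) by (auto simp: adj_def transpose_def)
    then show ?case
      using monk_adj[OF S_inftyI[OF ascent(1)] ascent(2,4)] ascent(5) by (auto simp: comp_def)
  qed simp
  then show ?thesis using n assms by (auto simp: monk_def)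
qed

section \<open>A Pieri formula\<close>

subsection \<open>Chains in the k-Bruhat order\<close>

text \<open>The relation \<open>arrow\<close> with the list of transpositions forgotten except for
  the set of lower positions used. This leaves room to reorder steps and to restrict which positions
  may move.\<close>

inductive chain :: "nat \<Rightarrow> (nat \<Rightarrow> nat) \<Rightarrow> nat set \<Rightarrow> (nat \<Rightarrow> nat) \<Rightarrow> bool" for k u where
  chain_refl: "chain k u {} u"
| chain_step: "chain k u A w \<Longrightarrow> a \<notin> A \<Longrightarrow> a \<le> k \<Longrightarrow> k < b \<Longrightarrow> covers w a b \<Longrightarrow>
    chain k u (insert a A) (w \<circ> transpose a b)"

lemma transp_prod_simps [simp]:
  "transp_prod [] = id" "transp_prod (ts @ [(a, b)]) = transp_prod ts \<circ> transpose a b"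
proof -
  have "foldr (\<lambda>(a, b) g. transpose a b \<circ> g) ts h = foldr (\<lambda>(a, b) g. transpose a b \<circ> g) ts id \<circ> h" for h
    by (induction ts) (auto simp: comp_assoc)
  then show "transp_prod (ts @ [(a, b)]) = transp_prod ts \<circ> transpose a b"
    unfolding transp_prod_def by simp
qed (simp add: transp_prod_def)

lemma chain_subset: "chain k u A w \<Longrightarrow> A \<subseteq> {1..k} \<and> finite A"
  by (induction rule: chain.induct) (auto simp: covers_def)

lemma chain_of_transps:
  assumes "\<forall>(a, b)\<in>set ts. 1 \<le> a \<and> a \<le> k \<and> k < b" "distinct (map fst ts)"
    and "\<forall>i\<in>{1..length ts}. len (u \<circ> transp_prod (take i ts)) = len u + i"
  shows "chain k u (fst ` set ts) (u \<circ> transp_prod ts)"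
  using assms
proof (induction ts rule: rev_induct)
  case Nil
  then show ?case by (simp add: chain_refl)
next
  case (snoc t ts)
  obtain a b where t: "t = (a, b)" by fastforce
  let ?w = "u \<circ> transp_prod ts"
  have lens: "len (u \<circ> transp_prod (take i ts)) = len u + i" if "i \<in> {1..length ts}" for i
    using bspec[OF snoc.prems(3), of i] that by (simp add: comp_def)
  have ch: "chain k u (fst ` set ts) ?w"
    using snoc.prems(1,2) by (intro snoc.IH[OF _ _ ballI[OF lens]]) auto
  have ab: "1 \<le> a" "a \<le> k" "k < b" "a \<notin> fst ` set ts" using snoc.prems t by auto
  have "len ?w = len u + length ts"
    using lens[of "length ts"] by (cases "ts = []") (simp_all add: Suc_leI)
  moreover have "len (?w \<circ> transpose a b) = len u + (length ts + 1)"
    using bspec[OF snoc.prems(3), of "length ts + 1"] t by (simp add: comp_def)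
  ultimately have "covers ?w a b" using ab by (simp add: covers_def)
  then have "chain k u (insert a (fst ` set ts)) (?w \<circ> transpose a b)"
    using ch ab by (intro chain_step)
  then show ?case using t by (simp add: comp_def)
qed

lemma transps_of_chain:
  assumes "chain k u A w"
  shows "\<exists>ts. (\<forall>(a, b)\<in>set ts. 1 \<le> a \<and> a \<le> k \<and> k < b) \<and> distinct (map fst ts) \<and>
    (\<forall>i\<in>{1..length ts}. len (u \<circ> transp_prod (take i ts)) = len u + i) \<and>
    fst ` set ts = A \<and> w = u \<circ> transp_prod ts"
  using assms
proof (induction rule: chain.induct)
  case chain_refl
  then show ?case by (intro exI[of _ "[]"]) simp
next
  case (chain_step A w a b)
  then obtain ts where ts: "\<forall>(a, b)\<in>set ts. 1 \<le> a \<and> a \<le> k \<and> k < b" "distinct (map fst ts)"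
    "\<And>i. i \<in> {1..length ts} \<Longrightarrow> len (u \<circ> transp_prod (take i ts)) = len u + i"
    "fst ` set ts = A" "w = u \<circ> transp_prod ts"
    by blast
  have lw: "len w = len u + length ts"
    using ts(3)[of "length ts"] ts(5) by (cases "ts = []") (simp_all add: Suc_leI)
  have w': "u \<circ> transp_prod (ts @ [(a, b)]) = w \<circ> transpose a b" using ts(5) by (simp add: comp_assoc)
  have "len (u \<circ> transp_prod (take i (ts @ [(a, b)]))) = len u + i"
    if "i \<in> {1..length (ts @ [(a, b)])}" for i
  proof (cases "i \<le> length ts")
    case True
    then show ?thesis using ts(3)[of i] that by simp
  next
    case False
    then have i: "i = length (ts @ [(a, b)])" using that by simp
    have "len (w \<circ> transpose a b) = len u + i"
      using chain_step(5) lw i unfolding covers_def by simp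
    then show ?thesis unfolding i take_all[OF order_refl] w' .
  qed
  then have "\<forall>i\<in>{1..length (ts @ [(a, b)])}.
      len (u \<circ> transp_prod (take i (ts @ [(a, b)]))) = len u + i"
    by blast
  moreover have "\<forall>(a, b)\<in>set (ts @ [(a, b)]). 1 \<le> a \<and> a \<le> k \<and> k < b"
    "distinct (map fst (ts @ [(a, b)]))" "fst ` set (ts @ [(a, b)]) = insert a A"
    using ts(1,2,4) chain_step(2,3,4,5) by (auto simp: covers_def)
  ultimately show ?case
    by (intro exI[of _ "ts @ [(a, b)]"] conjI) (assumption | rule w'[symmetric])+
qed

lemma arrow_iff_chain: "arrow k u w \<longleftrightarrow> (\<exists>A. chain k u A w)"
proof
  assume "arrow k u w"
  then show "\<exists>A. chain k u A w" unfolding arrow_def using chain_of_transps by blast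
next
  assume "\<exists>A. chain k u A w"
  then obtain A where A: "chain k u A w" by blast
  then obtain ts where ts: "\<forall>(a, b)\<in>set ts. 1 \<le> a \<and> a \<le> k \<and> k < b" "distinct (map fst ts)"
    "\<forall>i\<in>{1..length ts}. len (u \<circ> transp_prod (take i ts)) = len u + i"
    "fst ` set ts = A" "w = u \<circ> transp_prod ts"
    using transps_of_chain by blast
  \<comment> \<open>The bound on the number of steps comes from distinct lower positions in
    \<open>{1..k}\<close>.\<close>
  have "length ts = card A" using distinct_card[OF ts(2)] ts(4) by simp
  also have "\<dots> \<le> k" using card_mono[of "{1..k}" A] chain_subset[OF A] by simp
  finally show "arrow k u w" unfolding arrow_def using ts by blast
qed

lemma chain_in_S_infty: "chain k u A w \<Longrightarrow> u \<in> S_infty \<Longrightarrow> w \<in> S_infty"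
  by (induction rule: chain.induct) (auto simp: covers_def)

text \<open>A step raises the value at its lower position and otherwise changes only a position
  beyond \<open>k\<close>. Hence \<open>A\<close> is determined by \<open>u\<close> and
  \<open>w\<close>, and the weight is the product over the positions outside it.\<close>

lemma chain_values:
  assumes "chain k u A w" "u \<in> S_infty" "i \<le> k"
  shows "(i \<notin> A \<longrightarrow> w i = u i) \<and> (i \<in> A \<longrightarrow> u i < w i)"
  using assms
proof (induction rule: chain.induct)
  case (chain_step A w a b)
  have "w a < w b"
    using covers_less[OF chain_in_S_infty[OF chain_step(1)] chain_step(5)] chain_step by simp
  then show ?case using chain_step by (cases "i = a") auto
qed simp

text \<open>The critical case is \<open>a = i\<close>: the new value \<open>w b\<close> cannot jump
  over \<open>w (Suc i)\<close>, because \<open>Suc i\<close> lies between \<open>a\<close> and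
  \<open>b\<close> and a cover has no intermediate value.\<close>

lemma ascent_step:
  assumes w: "w \<in> S_infty" and i: "Suc i \<le> k" "w i < w (Suc i)"
    and ab: "a \<le> k" "k < b" "covers w a b"
  shows "(w \<circ> transpose a b) i < (w \<circ> transpose a b) (Suc i)"
proof -
  have less: "w a < w b" using covers_less[OF w ab(3)] ab by simp
  consider "a = i" | "a = Suc i" | "a \<noteq> i" "a \<noteq> Suc i" by blast
  then show ?thesis
  proof cases
    case 1
    then have "\<not> w (Suc i) < w b" using covers_not_between[OF w ab(3), of "Suc i"] i ab by simp
    moreover have "w b \<noteq> w (Suc i)" using S_infty_inj[OF w] i ab by auto
    ultimately show ?thesis using 1 i ab by simp
  next
    case 2
    then show ?thesis using less i ab by simp
  next
    case 3
    then show ?thesis using i ab by simp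
  qed
qed

lemma chain_ascent:
  assumes "chain k u A w" "u \<in> S_infty" "Suc i \<le> k" "u i < u (Suc i)"
  shows "w i < w (Suc i)"
  using assms
proof (induction rule: chain.induct)
  case (chain_step A w a b)
  then show ?case using ascent_step[of w i k a b] chain_in_S_infty by blast
qed simp

text \<open>As the ascent at \<open>i\<close> persists, \<open>covers_adj_iff\<close> carries every
  step over to the permuted lower positions.\<close>

lemma chain_adj_ascent:
  assumes "chain k u A w" "u \<in> S_infty" "1 \<le> i" "Suc i \<le> k" "u i < u (Suc i)"
  shows "chain k (u \<circ> adj i) (adj i ` A) (w \<circ> adj i)"
  using assms
proof (induction rule: chain.induct)
  case chain_refl
  show ?case by (simp add: chain.chain_refl)
next
  case (chain_step A w a b)
  have w: "w \<in> S_infty" using chain_in_S_infty chain_step by blast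
  have asc: "w i < w (Suc i)" using chain_ascent chain_step by blast
  have b: "adj i b = b" using chain_step by (simp add: adj_def)
  have ak: "adj i a \<le> k" using chain_step(3,9) by (auto simp: adj_def transpose_def)
  then have ne: "b \<noteq> a" "b \<noteq> adj i a" using chain_step(3,4) by auto
  have "covers (w \<circ> adj i) (adj i a) b"
    using covers_adj_iff(1)[OF w chain_step(8) asc ne] chain_step(5) b by simp
  moreover have "adj i a \<notin> adj i ` A" using chain_step(2) by (metis adj_simps(4) imageE)
  ultimately have "chain k (u \<circ> adj i) (insert (adj i a) (adj i ` A)) (w \<circ> adj i \<circ> transpose (adj i a) b)"
    using chain_step(3,4) chain_step.IH[OF chain_step.prems] ak by (intro chain.chain_step)
  then show ?case using covers_adj_iff(2)[OF w chain_step(8) asc ne] b by (simp add: comp_def)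
qed

text \<open>The inverse construction. Since ascents persist, a descent at the end of the chain was
  present at every earlier stage.\<close>

lemma chain_adj_descent:
  assumes "chain k u A w" "u \<in> S_infty" "1 \<le> i" "Suc i \<le> k" "w (Suc i) < w i"
  shows "chain k (u \<circ> adj i) (adj i ` A) (w \<circ> adj i)"
  using assms
proof (induction rule: chain.induct)
  case chain_refl
  show ?case by (simp add: chain.chain_refl)
next
  case (chain_step A w a b)
  have w: "w \<in> S_infty" using chain_in_S_infty chain_step by blast
  have "\<not> w i < w (Suc i)" using ascent_step[OF w _ _ chain_step(3,4,5)] chain_step by fastforce
  then have desc: "w (Suc i) < w i" using S_infty_inj[OF w, of i "Suc i"] by (meson n_not_Suc_n nat_neq_iff)
  let ?w = "w \<circ> adj i"
  have ws: "?w \<in> S_infty" using w chain_step by simp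
  have b: "adj i b = b" using chain_step by (simp add: adj_def)
  have ak: "adj i a \<le> k" using chain_step(3,9) by (auto simp: adj_def transpose_def)
  then have ne: "b \<noteq> adj i a" "b \<noteq> adj i (adj i a)" using chain_step(3,4) by auto
  have asc: "?w i < ?w (Suc i)" using desc by simp
  \<comment> \<open>The ascent belongs to \<open>?w\<close>, so the equivalence is used from its
    right-hand side, which speaks of \<open>w\<close> and \<open>a\<close>.\<close>
  note c = covers_adj_iff[OF ws chain_step(8) asc ne]
  have eq: "w \<circ> transpose a b = ?w \<circ> transpose (adj i a) b \<circ> adj i"
    using c(2) unfolding comp_adj_adj adj_simps(4) b .
  then have eq': "?w \<circ> transpose (adj i a) b = w \<circ> transpose a b \<circ> adj i"
    by (simp only: comp_adj_adj)
  have "(?w \<circ> transpose (adj i a) b) i < (?w \<circ> transpose (adj i a) b) (Suc i)"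
    unfolding eq' using chain_step(10) by simp
  then have "covers ?w (adj i a) b" using c(1) chain_step(5) unfolding comp_adj_adj adj_simps(4) b by blast
  moreover have "adj i a \<notin> adj i ` A" using chain_step(2) by (metis adj_simps(4) imageE)
  moreover have "chain k (u \<circ> adj i) (adj i ` A) ?w"
    using chain_step.IH[OF chain_step(7,8,9) desc] .
  ultimately have "chain k (u \<circ> adj i) (insert (adj i a) (adj i ` A)) (?w \<circ> transpose (adj i a) b)"
    using chain_step(4) ak by (intro chain.chain_step)
  then show ?case unfolding eq' by (simp add: comp_def)
qed

text \<open>
  When \<open>u\<close> decreases on \<open>{1..k}\<close>, the step at the largest position \<open>a\<close> commutes with all later
  ones: a later step \<open>c < a\<close> at the same upper position would have to go down, as \<open>u c > u a\<close>.
\<close>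

lemma chain_last:
  assumes "chain k u A w" "u \<in> S_infty"
    and "\<And>i j. 1 \<le> i \<Longrightarrow> i < j \<Longrightarrow> j \<le> k \<Longrightarrow> u j < u i"
    and "a \<in> A" "\<And>i. i \<in> A \<Longrightarrow> i \<le> a"
  shows "\<exists>w' b. chain k u (A - {a}) w' \<and> k < b \<and> covers w' a b \<and> w = w' \<circ> transpose a b"
  using assms(1,4,5)
proof (induction rule: chain.induct)
  case (chain_step A w c b)
  show ?case
  proof (cases "c = a")
    case True
    then show ?thesis using chain_step by (intro exI[of _ w] exI[of _ b]) simp
  next
    case False
    then have ca: "a \<in> A" "c < a" using chain_step(7) chain_step(8)[of c] by auto
    then obtain w' d where w': "chain k u (A - {a}) w'" "k < d" "covers w' a d" "w = w' \<circ> transpose a d"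
      using chain_step.IH chain_step(8) by blast
    have ak: "a \<le> k" using chain_subset[OF chain_step(1)] ca by auto
    have S: "w' \<in> S_infty" "w \<in> S_infty"
      using chain_in_S_infty[OF w'(1) assms(2)] chain_in_S_infty[OF chain_step(1) assms(2)] .
    have c1: "1 \<le> c" "1 \<le> b" "1 \<le> a" "1 \<le> d" using chain_step(5) w'(3) by (auto simp: covers_def)
    have vals: "w' a = u a" "w' c = u c"
      using chain_values[OF w'(1) assms(2), of a] chain_values[OF w'(1) assms(2), of c]
        ak chain_step(2,3) by auto
    have less: "w c < w b" using covers_less[OF S(2) chain_step(5)] chain_step(3,4) by simp
    have wc: "w c = w' c" using w'(2,4) ca ak chain_step(3) by simp
    have bd: "b \<noteq> d"
    proof
      assume "b = d"
      then have "w b = u a" using w'(4) vals by simp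
      then show False using less wc vals assms(3)[OF c1(1) ca(2) ak] by simp
    qed
    let ?x = "w' \<circ> transpose c b"
    have x: "?x \<in> S_infty" using S c1 by simp
    \<comment> \<open>The four positions are distinct, so the transpositions commute.\<close>
    have com: "w \<circ> transpose c b = ?x \<circ> transpose a d"
      using w'(4,2) bd ca ak chain_step(3,4) by (auto simp: fun_eq_iff transpose_def)
    have "w b = w' b" using w'(4) bd ak chain_step(4) by simp
    then have "w' c < w' b" using less wc by simp
    then have l1: "len w' < len ?x"
      using len_transpose_less[OF S(1) c1(1)] chain_step(3,4) by simp
    have "w' a < w' d" using covers_less[OF S(1) w'(3)] ak w'(2) by simp
    moreover have "?x a = w' a" "?x d = w' d"
      using bd ca ak w'(2) chain_step(3,4) by simp_all
    ultimately have l2: "len ?x < len (?x \<circ> transpose a d)"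
      using len_transpose_less[OF x c1(3)] ak w'(2) by simp
    have "len (w \<circ> transpose c b) = len w + 1" "len w = len w' + 1"
      using chain_step(5) w'(3,4) by (simp_all add: covers_def)
    then have "len (?x \<circ> transpose a d) = len w' + 2" by (simp only: com)
    \<comment> \<open>Two strict increases with total two are both covers.\<close>
    then have "len ?x = len w' + 1" "len (?x \<circ> transpose a d) = len ?x + 1" using l1 l2 by linarith+
    then have cov: "covers w' c b" "covers ?x a d"
      using c1 chain_step(3,4) ak w'(2) unfolding covers_def by auto
    have "chain k u (insert c (A - {a})) ?x"
      using w'(1) chain_step(2,3,4) cov(1) by (intro chain.chain_step) auto
    moreover have "insert c A - {a} = insert c (A - {a})" using False by auto
    ultimately have "chain k u (insert c A - {a}) ?x" by (simp only:)
    then show ?thesis using cov(2) w'(2) com by blast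
  qed
qed simp

text \<open>Induction on the number of steps, which is \<open>card A\<close> and at most
  \<open>k\<close>; each permutation has finitely many covers at a given position.\<close>

lemma finite_chain:
  assumes u: "u \<in> S_infty"
  shows "finite {w. \<exists>A. chain k u A w}"
proof -
  let ?L = "\<lambda>m. {w. \<exists>A. chain k u A w \<and> card A = m}"
  have "finite (?L m)" for m
  proof (induction m)
    case 0
    have "w = u" if "chain k u A w" "card A = 0" for A w
      using that(1)
    proof cases
      case (chain_step A' w' a b)
      then have "A \<noteq> {}" "finite A" using chain_subset[OF that(1)] by auto
      then show ?thesis using that(2) by simp
    qed
    then have "?L 0 \<subseteq> {u}" by blast
    then show ?case by (rule finite_subset) simp
  next
    case (Suc m)
    have "?L (Suc m) \<subseteq> (\<Union>w\<in>?L m. \<Union>a\<in>{..k}. (\<lambda>b. w \<circ> transpose a b) ` {b. covers w a b})"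
    proof
      fix w assume "w \<in> ?L (Suc m)"
      then obtain A where A: "chain k u A w" "card A = Suc m" by blast
      from A(1) show "w \<in> (\<Union>w\<in>?L m. \<Union>a\<in>{..k}. (\<lambda>b. w \<circ> transpose a b) ` {b. covers w a b})"
      proof cases
        case chain_refl
        then show ?thesis using A by simp
      next
        case (chain_step A' w' a b)
        then have "card A' = m" using A(2) chain_subset[OF chain_step(3)] by simp
        then show ?thesis using chain_step by fast
      qed
    qed
    moreover have "finite {b. covers w a b}" if "w \<in> ?L m" for w a
      using that chain_in_S_infty[OF _ u] finite_covers by blast
    ultimately show ?case using Suc.IH by (elim finite_subset) blast
  qed
  moreover have "{w. \<exists>A. chain k u A w} \<subseteq> (\<Union>m\<in>{..k}. ?L m)"
  proof clarify
    fix w A assume A: "chain k u A w"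
    then have "card A \<le> k" using chain_subset[OF A] card_mono[of "{1..k}" A] by simp
    then show "w \<in> (\<Union>m\<in>{..k}. ?L m)" using A by blast
  qed
  ultimately show ?thesis by (meson finite_UN_I finite_atMost finite_subset)
qed

subsection \<open>The Pieri formula\<close>

text \<open>The set records values rather than positions, so permuting positions within
  \<open>{1..k}\<close> does not affect it.\<close>

lemma fixed_values_adj:
  assumes "1 \<le> i" "Suc i \<le> k"
  shows "fixed_values k (u \<circ> adj i) (w \<circ> adj i) = fixed_values k u w"
proof -
  have sub: "fixed_values k u w \<subseteq> fixed_values k (u \<circ> adj i) (w \<circ> adj i)" for u w
  proof
    fix x assume "x \<in> fixed_values k u w"
    then obtain j where j: "x = u j" "1 \<le> j" "j \<le> k" "u j = w j" by (auto simp: fixed_values_def)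
    then have "1 \<le> adj i j \<and> adj i j \<le> k" using assms by (auto simp: adj_def transpose_def)
    then show "x \<in> fixed_values k (u \<circ> adj i) (w \<circ> adj i)"
      using j by (auto simp: fixed_values_def intro!: exI[of _ "adj i j"])
  qed
  from sub[of u w] sub[of "u \<circ> adj i" "w \<circ> adj i"] show ?thesis by simp
qed

lemma weight_eq:
  assumes "u \<in> S_infty"
  shows "weight u k w j = (\<Prod>i\<in>{i\<in>{1..k}. u i = w i}. Y (u i) - Z j)"
proof -
  have "fixed_values k u w = u ` {i\<in>{1..k}. u i = w i}"
    unfolding fixed_values_def image_def atLeastAtMost_iff by blast
  moreover have "inj_on u {i\<in>{1..k}. u i = w i}"
    unfolding inj_on_def using S_infty_inj[OF assms] by blast
  ultimately show ?thesis unfolding weight_def by (simp only: prod.reindex comp_def)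
qed

definition pieri :: "nat \<Rightarrow> nat \<Rightarrow> (nat \<Rightarrow> nat) \<Rightarrow> bool" where
  "pieri k j u \<longleftrightarrow> (\<Prod>i\<in>{1..k}. X i - Z j) * schubert_xy u =
    (\<Sum>w\<in>{w. arrow k u w}. weight u k w j * schubert_xy w)"

lemma pieri_adj:
  assumes u: "u \<in> S_infty" and i: "1 \<le> i" "Suc i \<le> k" "u i < u (Suc i)"
    and pieri: "pieri k j (u \<circ> adj i)"
  shows "pieri k j u"
proof -
  let ?v = "u \<circ> adj i" and ?E = "\<Prod>i\<in>{1..k}. X i - Z j"
  have v: "?v \<in> S_infty" using u i by simp
  have E: "act i ?E = ?E"
    unfolding act_hom act_X act_Z
  proof (intro prod.reindex_bij_witness[of "{1..k}" "adj i" "adj i"])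
    fix a assume "a \<in> {1..k}"
    then show "adj i a \<in> {1..k}" "adj i a \<in> {1..k}" using i by (auto simp: adj_def transpose_def)
  qed simp_all
  have act_weight: "act i (weight ?v k w j) = weight ?v k w j" for w
    by (simp add: weight_def act_hom)
  have arrow_S: "w \<in> S_infty" if "arrow k ?v w" for w
    using that chain_in_S_infty[OF _ v] by (auto simp: arrow_iff_chain)
  have "divdiff i (schubert_xy ?v) = schubert_xy u"
    using divdiff_schubert_descent[OF v i(1)] i by simp
  then have "?E * schubert_xy u = divdiff i (?E * schubert_xy ?v)"
    by (simp only: divdiff_mult_left[OF E])
  also have "\<dots> = (\<Sum>w\<in>{w. arrow k ?v w}. weight ?v k w j * divdiff i (schubert_xy w))"
    unfolding pieri[unfolded pieri_def] by (simp add: divdiff_sum divdiff_mult_left act_weight)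
  also have "\<dots> = (\<Sum>w\<in>{w. arrow k ?v w \<and> w (Suc i) < w i}. weight ?v k w j * schubert_xy (w \<circ> adj i))"
  proof (rule sum.mono_neutral_cong_right)
    show "finite {w. arrow k ?v w}" using finite_chain[OF v] by (simp add: arrow_iff_chain)
  qed (use divdiff_schubert[OF arrow_S i(1)] in auto)
  \<comment> \<open>Multiplication by \<open>adj i\<close> matches the targets from
    \<open>?v\<close> with a descent at \<open>i\<close> and all targets from \<open>u\<close>:
    \<open>chain_adj_descent\<close> and \<open>chain_adj_ascent\<close> give the two
    directions.\<close>
  also have "\<dots> = (\<Sum>w\<in>{w. arrow k u w}. weight u k w j * schubert_xy w)"
  proof (rule sum.reindex_bij_witness[of _ "\<lambda>w. w \<circ> adj i" "\<lambda>w. w \<circ> adj i"])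
    fix w assume w: "w \<in> {w. arrow k ?v w \<and> w (Suc i) < w i}"
    then show "w \<circ> adj i \<in> {w. arrow k u w}"
      using chain_adj_descent[OF _ v i(1,2)] by (auto simp: arrow_iff_chain)
    show "weight u k (w \<circ> adj i) j * schubert_xy (w \<circ> adj i) = weight ?v k w j * schubert_xy (w \<circ> adj i)"
      using fixed_values_adj[OF i(1,2), of u "w \<circ> adj i"] by (simp add: weight_def)
  next
    fix w assume "w \<in> {w. arrow k u w}"
    then obtain A where A: "chain k u A w" by (auto simp: arrow_iff_chain)
    then have "(w \<circ> adj i) (Suc i) < (w \<circ> adj i) i" using chain_ascent[OF A u] i by simp
    then show "w \<circ> adj i \<in> {w. arrow k ?v w \<and> w (Suc i) < w i}"
      using chain_adj_ascent[OF A u i] by (auto simp: arrow_iff_chain)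
  qed simp_all
  finally show ?thesis unfolding pieri_def .
qed

text \<open>
  If \<open>u\<close> decreases on \<open>{1..k}\<close>, then multiplying by \<open>x\<^sub>1 - z\<^sub>j\<close>, ..., \<open>x\<^sub>k - z\<^sub>j\<close> in this order
  meets no negative terms of Monk's formula.
\<close>

lemma pieri_decreasing:
  assumes u: "u \<in> S_infty" and decr: "\<And>i j. 1 \<le> i \<Longrightarrow> i < j \<Longrightarrow> j \<le> k \<Longrightarrow> u j < u i"
  shows "pieri k j u"
proof -
  \<comment> \<open>\<open>C m\<close> collects the endpoints that occur after multiplication by the
    first \<open>m\<close> factors, with coefficients \<open>wt m\<close>.\<close>
  define C where "C m = {w. \<exists>A. chain k u A w \<and> A \<subseteq> {1..m}}" for m
  define wt where "wt m w = (\<Prod>i\<in>{i\<in>{1..m}. u i = w i}. Y (u i) - Z j)" for m w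
  have finC: "finite (C m)" for m
    by (rule finite_subset[OF _ finite_chain[OF u, of k]]) (auto simp: C_def)
  have S: "w \<in> S_infty" if "w \<in> C m" for m w using that chain_in_S_infty[OF _ u] by (auto simp: C_def)
  have "(\<Prod>i\<in>{1..m}. X i - Z j) * schubert_xy u = (\<Sum>w\<in>C m. wt m w * schubert_xy w)" if "m \<le> k" for m
    using that
  proof (induction m)
    case 0
    have "w = u" if "chain k u {} w" for w using that by cases auto
    then have "C 0 = {u}" by (auto simp: C_def intro: chain_refl)
    then show ?case by (simp add: wt_def)
  next
    case (Suc m)
    define a where "a = Suc m"
    have a: "1 \<le> a" "a \<le> k" using Suc.prems by (auto simp: a_def)
    have wa: "w a = u a" if w: "w \<in> C m" for w
    proof -
      obtain A where "chain k u A w" "A \<subseteq> {1..m}" using w by (auto simp: C_def)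
      moreover from this have "a \<notin> A" by (auto simp: a_def)
      ultimately show ?thesis using chain_values[OF _ u a(2)] by blast
    qed
    \<comment> \<open>This excludes the negative terms. At a position \<open>b < a\<close> the value
      is at least \<open>u b\<close>, hence above \<open>u a\<close>; at a position \<open>b\<close>
      with \<open>a < b \<le> k\<close> it is still \<open>u b\<close>, hence below
      \<open>u a\<close>. A transposition of either kind with \<open>a\<close> would shorten
      \<open>w\<close>.\<close>
    have above: "k < b" if w: "w \<in> C m" and cov: "covers w a b" for w b
    proof (rule ccontr)
      assume "\<not> k < b"
      then have bk: "b \<le> k" by simp
      have b: "1 \<le> b" "b \<noteq> a" using cov by (auto simp: covers_def)
      obtain A where A: "chain k u A w" "A \<subseteq> {1..m}" using w by (auto simp: C_def)
      note vb = chain_values[OF A(1) u bk]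
      show False
      proof (cases "b < a")
        case True
        then have "w b < w a" using covers_less[OF S[OF w], of b a] cov covers_commute by blast
        moreover have "u b \<le> w b" using vb by (cases "b \<in> A") auto
        ultimately show False using decr[OF b(1) True a(2)] wa[OF w] by simp
      next
        case False
        then have ab: "a < b" using b by simp
        then have "w a < w b" using covers_less[OF S[OF w] cov] by simp
        moreover have "b \<notin> A" using A(2) ab by (auto simp: a_def)
        ultimately show False using decr[OF a(1) ab bk] wa[OF w] vb by simp
      qed
    qed
    define D where "D = (SIGMA w:C m. {b. covers w a b})"
    define move :: "(nat \<Rightarrow> nat) \<times> nat \<Rightarrow> nat \<Rightarrow> nat" where "move = (\<lambda>(w, b). w \<circ> transpose a b)"
    have move_a: "move (w, b) a \<noteq> u a" if "(w, b) \<in> D" for w b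
    proof -
      have w: "w \<in> C m" "covers w a b" using that by (auto simp: D_def)
      then have "w b \<noteq> w a" using S_infty_inj[OF S[OF w(1)]] by (auto simp: covers_def)
      then show ?thesis using wa[OF w(1)] by (simp add: move_def)
    qed
    have finD: "finite D" unfolding D_def using finC finite_covers S by auto
    \<comment> \<open>The pair can be recovered: \<open>b\<close> is the position at which the
      result takes the value \<open>u a\<close>.\<close>
    have inj: "inj_on move D"
    proof (rule inj_onI, clarify)
      fix w b w' b' assume D: "(w, b) \<in> D" "(w', b') \<in> D" and eq: "move (w, b) = move (w', b')"
      have w: "w \<in> C m" "w' \<in> C m" "covers w a b" "covers w' a b'" using D by (auto simp: D_def)
      have "move (w, b) \<in> S_infty" using S[OF w(1)] w(3) by (auto simp: move_def covers_def)
      moreover have "move (w, b) b = u a" "move (w', b') b' = u a"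
        using wa[OF w(1)] wa[OF w(2)] by (simp_all add: move_def)
      ultimately have "b = b'" using eq S_infty_inj by metis
      moreover have "w = move (w, b) \<circ> transpose a b" "w' = move (w', b') \<circ> transpose a b'"
        by (simp_all add: move_def)
      ultimately show "w = w' \<and> b = b'" using eq by metis
    qed
    \<comment> \<open>A chain using position \<open>a\<close> can be rearranged by
      \<open>chain_last\<close> so that \<open>a\<close> moves last; then its beginning is counted
      in \<open>C m\<close>.\<close>
    have CD: "C (Suc m) = C m \<union> move ` D"
    proof (intro equalityI subsetI)
      fix w assume "w \<in> C (Suc m)"
      then obtain A where A: "chain k u A w" "A \<subseteq> {1..a}" by (auto simp: C_def a_def)
      show "w \<in> C m \<union> move ` D"
      proof (cases "a \<in> A")
        case True
        have "i \<le> a" if "i \<in> A" for i using A(2) that by auto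
        from chain_last[OF A(1) u decr True this]
        obtain w' b where w': "chain k u (A - {a}) w'" "covers w' a b" "w = w' \<circ> transpose a b"
          by blast
        have "A - {a} \<subseteq> {1..m}" using A(2) by (auto simp: a_def le_Suc_eq)
        then have "(w', b) \<in> D" using w' by (auto simp: D_def C_def)
        then show ?thesis using w'(3) by (force simp: move_def)
      next
        case False
        then have "A \<subseteq> {1..m}" using A(2) by (auto simp: a_def le_Suc_eq)
        then show ?thesis using A(1) by (auto simp: C_def)
      qed
    next
      fix w assume "w \<in> C m \<union> move ` D"
      then consider "w \<in> C m" | w' b where "w' \<in> C m" "covers w' a b" "w = w' \<circ> transpose a b"
        by (auto simp: D_def move_def)
      then show "w \<in> C (Suc m)"
      proof cases
        case 1
        then show ?thesis by (fastforce simp: C_def)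
      next
        case 2
        then obtain A where A: "chain k u A w'" "A \<subseteq> {1..m}" by (auto simp: C_def)
        then have "a \<notin> A" by (auto simp: a_def)
        then have "chain k u (insert a A) w"
          unfolding 2(3) using A(1) a(2) above[OF 2(1,2)] 2(2) by (intro chain_step)
        moreover have "insert a A \<subseteq> {1..Suc m}" using A(2) by (auto simp: a_def)
        ultimately show ?thesis by (auto simp: C_def)
      qed
    qed
    have disj: "C m \<inter> move ` D = {}"
      using move_a wa by fastforce
    have wt_stay: "wt (Suc m) w = (Y (u a) - Z j) * wt m w" if "w \<in> C m" for w
    proof -
      have "{i\<in>{1..Suc m}. u i = w i} = insert a {i\<in>{1..m}. u i = w i}"
        using wa[OF that] by (auto simp: a_def le_Suc_eq)
      then show ?thesis by (simp add: wt_def a_def)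
    qed
    \<comment> \<open>Position \<open>a\<close> is no longer fixed and contributes no factor, while
      the positions up to \<open>m\<close> keep their values.\<close>
    have wt_move: "wt (Suc m) (move (w, b)) = wt m w" if "(w, b) \<in> D" for w b
    proof -
      have "k < b" using above that by (auto simp: D_def)
      then have "move (w, b) i = w i" if "i \<le> m" for i
        using that a by (simp add: move_def a_def)
      then have "{i\<in>{1..Suc m}. u i = move (w, b) i} = {i\<in>{1..m}. u i = w i}"
        using move_a[OF that] by (auto simp: a_def le_Suc_eq)
      then show ?thesis by (simp add: wt_def)
    qed
    have monk: "(X a - Z j) * schubert_xy w = (Y (u a) - Z j) * schubert_xy w +
        (\<Sum>b\<in>{b. covers w a b}. schubert_xy (move (w, b)))" if "w \<in> C m" for w
    proof -
      have "transp_sign a b = 1" if "covers w a b" for b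
        using above[OF \<open>w \<in> C m\<close> that] a by (simp add: transp_sign_def)
      then show ?thesis
        using monk_formula[OF S[OF that] a(1)] wa[OF that] by (simp add: move_def left_diff_distrib)
    qed
    have "(\<Prod>i\<in>{1..Suc m}. X i - Z j) * schubert_xy u =
        (X a - Z j) * ((\<Prod>i\<in>{1..m}. X i - Z j) * schubert_xy u)"
      by (simp add: a_def mult_ac)
    also have "\<dots> = (\<Sum>w\<in>C m. wt m w * ((X a - Z j) * schubert_xy w))"
      using Suc by (simp add: sum_distrib_left mult_ac)
    also have "\<dots> = (\<Sum>w\<in>C m. wt (Suc m) w * schubert_xy w +
        (\<Sum>b\<in>{b. covers w a b}. wt (Suc m) (move (w, b)) * schubert_xy (move (w, b))))"
    proof (rule sum.cong[OF refl])
      fix w assume w: "w \<in> C m"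
      have eq: "(\<Sum>b\<in>{b. covers w a b}. wt (Suc m) (move (w, b)) * schubert_xy (move (w, b))) =
          wt m w * (\<Sum>b\<in>{b. covers w a b}. schubert_xy (move (w, b)))"
        unfolding sum_distrib_left using w by (intro sum.cong refl) (simp add: wt_move D_def)
      show "wt m w * ((X a - Z j) * schubert_xy w) = wt (Suc m) w * schubert_xy w +
          (\<Sum>b\<in>{b. covers w a b}. wt (Suc m) (move (w, b)) * schubert_xy (move (w, b)))"
        unfolding eq monk[OF w] wt_stay[OF w] distrib_left by (simp only: mult_ac)
    qed
    also have "\<dots> = (\<Sum>w\<in>C m. wt (Suc m) w * schubert_xy w) +
        (\<Sum>p\<in>D. wt (Suc m) (move p) * schubert_xy (move p))"
      unfolding D_def sum.distrib
      by (subst sum.Sigma) (use finC finite_covers S in \<open>auto simp: split_def\<close>)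
    also have "\<dots> = (\<Sum>w\<in>C m. wt (Suc m) w * schubert_xy w) +
        (\<Sum>w\<in>move ` D. wt (Suc m) w * schubert_xy w)"
      by (simp add: sum.reindex[OF inj])
    also have "\<dots> = (\<Sum>w\<in>C (Suc m). wt (Suc m) w * schubert_xy w)"
      unfolding CD using finC finD disj by (intro sum.union_disjoint[symmetric]) auto
    finally show ?case .
  qed
  from this[of k] have "(\<Prod>i\<in>{1..k}. X i - Z j) * schubert_xy u = (\<Sum>w\<in>C k. wt k w * schubert_xy w)"
    by simp
  moreover have "(\<exists>A. chain k u A w \<and> A \<subseteq> {1..k}) \<longleftrightarrow> arrow k u w" for w
    unfolding arrow_iff_chain using chain_subset[of k u _ w] by blast
  ultimately show ?thesis unfolding pieri_def C_def weight_eq[OF u] wt_def by (simp only:)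
qed

theorem pieri_formula:
  assumes "u \<in> S_infty"
  shows "(\<Prod>i\<in>{1..k}. X i - Z j) * schubert_xy u =
    (\<Sum>w\<in>{w. arrow k u w}. weight u k w j * schubert_xy w)"
proof -
  obtain n where n: "k \<le> n" "u permutes {1..n + 1}" using S_infty_permutes_above[OF assms] .
  have "k - 1 \<le> n" using n by simp
  have "pieri k j u"
    using n(2)
  \<comment> \<open>Only ascents at \<open>i < k\<close> are followed, so the induction stops when
    \<open>u\<close> decreases on \<open>{1..k}\<close>.\<close>
  proof (induction rule: ascent_induct[where k = "k - 1"])
    case (stop u)
    note S = S_inftyI[OF stop(1)]
    have desc: "u (Suc i) < u i" if "1 \<le> i" "Suc i \<le> k" for i
    proof -
      have "\<not> u i < u (Suc i)" using stop(2) that by auto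
      then show ?thesis using S_infty_inj[OF S, of i "Suc i"] by (meson n_not_Suc_n nat_neq_iff)
    qed
    have "i < j \<Longrightarrow> j \<le> k \<Longrightarrow> u j < u i" if "1 \<le> i" for i j
    proof (induction j)
      case (Suc j)
      then show ?case using desc[of j] that by (cases "i = j") auto
    qed simp
    then show ?case using pieri_decreasing[OF S] by blast
  next
    case (ascent u i)
    then have "Suc i \<le> k" by simp
    then show ?case using pieri_adj[OF S_inftyI[OF ascent(1)] ascent(2) _ ascent(4,5)] by blast
  qed fact
  then show ?thesis unfolding pieri_def .
qed

section \<open>The product formula\<close>

subsection \<open>Paths\<close>

text \<open>The endpoint is left free, so that a path can be extended by one step in an
  induction.\<close>

definition paths_from :: "nat list \<Rightarrow> (nat \<Rightarrow> nat) \<Rightarrow> (nat \<Rightarrow> nat) list set" where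
  "paths_from lam u = {p. length p = length lam + 1 \<and> p ! 0 = u \<and>
    (\<forall>i<length lam. arrow (lam ! i) (p ! i) (p ! (i + 1)))}"

lemma arrow_in_S_infty: "arrow k u w \<Longrightarrow> u \<in> S_infty \<Longrightarrow> w \<in> S_infty"
  using chain_in_S_infty by (auto simp: arrow_iff_chain)

lemma finite_arrow: "u \<in> S_infty \<Longrightarrow> finite {w. arrow k u w}"
  using finite_chain by (simp add: arrow_iff_chain)

lemma paths_from_in_S_infty:
  assumes "p \<in> paths_from lam u" "u \<in> S_infty" "i \<le> length lam"
  shows "p ! i \<in> S_infty"
  using assms(3)
proof (induction i)
  case 0
  then show ?case using assms by (simp add: paths_from_def)
next
  case (Suc i)
  then have "arrow (lam ! i) (p ! i) (p ! (i + 1))" using assms(1) by (simp add: paths_from_def)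
  then show ?case using arrow_in_S_infty Suc by simp
qed

lemma paths_eq_paths_from:
  assumes "u \<in> S_infty"
  shows "paths lam u w = {p \<in> paths_from lam u. p ! length lam = w}"
proof -
  have "set p \<subseteq> S_infty" if "p \<in> paths_from lam u" for p
  proof
    fix x assume "x \<in> set p"
    then obtain i where "i < length p" "x = p ! i" by (metis in_set_conv_nth)
    then show "x \<in> S_infty"
      using paths_from_in_S_infty[OF that assms, of i] that by (simp add: paths_from_def)
  qed
  then show ?thesis by (auto simp: paths_def paths_from_def)
qed

lemma paths_from_snoc:
  "paths_from (lam @ [k]) u =
    (\<lambda>(p, w). p @ [w]) ` (SIGMA p:paths_from lam u. {w. arrow k (p ! length lam) w})"
proof (intro equalityI subsetI)
  fix q assume q: "q \<in> paths_from (lam @ [k]) u"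
  then have len: "length q = length lam + 2" by (simp add: paths_from_def)
  define p where "p = butlast q"
  have qp: "q = p @ [last q]" using len by (cases q rule: rev_cases) (auto simp: p_def)
  have lp: "length p = length lam + 1" using len by (simp add: p_def)
  have nth: "p ! i = q ! i" if "i \<le> length lam" for i
    using that lp by (simp add: p_def nth_butlast)
  have step: "arrow ((lam @ [k]) ! i) (q ! i) (q ! (i + 1))" if "i \<le> length lam" for i
    using q that by (simp add: paths_from_def)
  have "p \<in> paths_from lam u"
    using q lp nth step by (auto simp: paths_from_def nth_append split: if_splits)
  moreover have "last q = q ! (length lam + 1)"
    using len by (cases q rule: rev_cases) (auto simp: nth_append)
  then have "arrow k (p ! length lam) (last q)"
    using step[of "length lam"] nth[of "length lam"] by simp
  ultimately have "(p, last q) \<in> (SIGMA p:paths_from lam u. {w. arrow k (p ! length lam) w})"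
    by simp
  then show "q \<in> (\<lambda>(p, w). p @ [w]) ` (SIGMA p:paths_from lam u. {w. arrow k (p ! length lam) w})"
    using qp by (metis (no_types, lifting) case_prod_conv image_eqI)
next
  fix q assume "q \<in> (\<lambda>(p, w). p @ [w]) ` (SIGMA p:paths_from lam u. {w. arrow k (p ! length lam) w})"
  then obtain p w where p: "p \<in> paths_from lam u" "arrow k (p ! length lam) w" "q = p @ [w]" by auto
  then show "q \<in> paths_from (lam @ [k]) u"
    by (auto simp: paths_from_def nth_append less_Suc_eq)
qed

lemma path_weight_snoc:
  assumes "length p = length lam + 1"
  shows "path_weight (lam @ [k]) (p @ [w]) =
    path_weight lam p * weight (p ! length lam) k w (length lam + 1)"
  using assms by (simp add: path_weight_def nth_append)

lemma finite_paths_from: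
  assumes "u \<in> S_infty"
  shows "finite (paths_from lam u)"
proof (induction lam rule: rev_induct)
  case Nil
  have "paths_from [] u \<subseteq> {[u]}"
    by (auto simp: paths_from_def length_Suc_conv)
  then show ?case by (rule finite_subset) simp
next
  case (snoc k lam)
  then show ?case
    unfolding paths_from_snoc
    using finite_arrow paths_from_in_S_infty[OF _ assms order_refl]
    by (intro finite_imageI finite_SigmaI) auto
qed

text \<open>The induction appends the last part of \<open>lam\<close>, which leaves the indices of
  the \<open>z\<close> variables of the earlier parts unchanged.\<close>

lemma pieri_paths:
  assumes u: "u \<in> S_infty"
  shows "(\<Prod>l<length lam. \<Prod>i\<in>{1..lam ! l}. X i - Z (l + 1)) * schubert_xy u =
    (\<Sum>p\<in>paths_from lam u. path_weight lam p * schubert_xy (p ! length lam))"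
proof (induction lam rule: rev_induct)
  case Nil
  have "paths_from [] u = {[u]}" by (auto simp: paths_from_def length_Suc_conv)
  then show ?case by (simp add: path_weight_def)
next
  case (snoc k lam)
  let ?n = "length lam"
  let ?A = "\<lambda>p. {w. arrow k (p ! ?n) w}"
  have S: "p ! ?n \<in> S_infty" if "p \<in> paths_from lam u" for p
    using paths_from_in_S_infty[OF that u] by simp
  have len: "length p = ?n + 1" if "p \<in> paths_from lam u" for p using that by (simp add: paths_from_def)
  have "(\<Prod>l<length (lam @ [k]). \<Prod>i\<in>{1..(lam @ [k]) ! l}. X i - Z (l + 1)) * schubert_xy u =
      (\<Prod>i\<in>{1..k}. X i - Z (?n + 1)) *
      ((\<Prod>l<?n. \<Prod>i\<in>{1..lam ! l}. X i - Z (l + 1)) * schubert_xy u)"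
    by (simp add: nth_append mult_ac)
  also have "\<dots> = (\<Sum>p\<in>paths_from lam u.
      path_weight lam p * ((\<Prod>i\<in>{1..k}. X i - Z (?n + 1)) * schubert_xy (p ! ?n)))"
    unfolding snoc.IH sum_distrib_left by (simp only: mult.left_commute)
  also have "\<dots> = (\<Sum>p\<in>paths_from lam u. \<Sum>w\<in>?A p.
      path_weight (lam @ [k]) (p @ [w]) * schubert_xy w)"
    by (intro sum.cong refl)
      (simp only: pieri_formula[OF S] sum_distrib_left path_weight_snoc[OF len] mult.assoc)
  also have "\<dots> = (\<Sum>(p, w)\<in>(SIGMA p:paths_from lam u. ?A p).
      path_weight (lam @ [k]) (p @ [w]) * schubert_xy w)"
    using finite_paths_from[OF u] finite_arrow[OF S] by (intro sum.Sigma) auto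
  also have "\<dots> = (\<Sum>q\<in>paths_from (lam @ [k]) u.
      path_weight (lam @ [k]) q * schubert_xy (q ! length (lam @ [k])))"
  proof -
    have inj: "inj_on (\<lambda>(p, w). p @ [w]) (SIGMA p:paths_from lam u. ?A p)" by (auto simp: inj_on_def)
    show ?thesis
      unfolding paths_from_snoc sum.reindex[OF inj]
      using len by (intro sum.cong refl) (auto simp: nth_append)
  qed
  finally show ?case .
qed

lemma d_coeff_eq_0:
  assumes "u \<in> S_infty" "w \<notin> (\<lambda>p. p ! length lam) ` paths_from lam u"
  shows "d_coeff u lam w = 0"
proof -
  have "paths lam u w = {}" using assms paths_eq_paths_from by auto
  then show ?thesis by (simp add: d_coeff_def)
qed

lemma pieri_d_coeff:
  assumes u: "u \<in> S_infty"
  shows "(\<Prod>l<length lam. \<Prod>i\<in>{1..lam ! l}. X i - Z (l + 1)) * schubert_xy u =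
    (\<Sum>w\<in>(\<lambda>p. p ! length lam) ` paths_from lam u. d_coeff u lam w * schubert_xy w)"
proof -
  have "(\<Sum>p\<in>paths_from lam u. path_weight lam p * schubert_xy (p ! length lam)) =
      (\<Sum>w\<in>(\<lambda>p. p ! length lam) ` paths_from lam u.
        \<Sum>p\<in>{p \<in> paths_from lam u. p ! length lam = w}. path_weight lam p * schubert_xy (p ! length lam))"
    by (rule sum.image_gen[OF finite_paths_from[OF u]])
  also have "\<dots> = (\<Sum>w\<in>(\<lambda>p. p ! length lam) ` paths_from lam u. d_coeff u lam w * schubert_xy w)"
    unfolding d_coeff_def paths_eq_paths_from[OF u] sum_distrib_right
    by (intro sum.cong refl) auto
  finally show ?thesis using pieri_paths[OF u] by simp
qed

text \<open>Only \<open>y\<close> and \<open>z\<close> occur, so these coefficients can be moved out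
  of divided differences.\<close>

lemma act_d_coeff: "act i (d_coeff u lam w) = d_coeff u lam w"
  by (simp add: d_coeff_def path_weight_def weight_def act_hom)

subsection \<open>Dominant approximation\<close>

lemma len_comp_word_prod_le:
  assumes "u \<in> S_infty" "\<forall>i\<in>set ws. 1 \<le> i"
  shows "len (u \<circ> word_prod ws) \<le> len u + length ws"
  using assms
proof (induction ws arbitrary: u)
  case (Cons i ws)
  have S: "u \<circ> adj i \<in> S_infty" and ws: "\<forall>i\<in>set ws. 1 \<le> i" using Cons.prems by simp_all
  have "len (u \<circ> adj i \<circ> word_prod ws) \<le> len (u \<circ> adj i) + length ws"
    using Cons.IH[OF S ws] .
  then show ?case using len_adj_bounds(1)[of u i] Cons.prems by (simp add: comp_def)
qed simp

text \<open>The recursion always multiplies at an ascent. Therefore lengths add up, and undoing one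
  step is one divided difference.\<close>

lemma dom_approx_props:
  assumes "v \<in> S_infty"
  shows "dom_approx v \<in> S_infty \<and> dominant (dom_approx v) \<and>
    (\<exists>ds. (\<forall>i\<in>set ds. 1 \<le> i) \<and> dom_approx v = v \<circ> word_prod ds \<and>
      len (dom_approx v) = len v + length ds \<and>
      schubert_xy v = divdiff_word ds (schubert_xy (dom_approx v)))"
  using assms
proof (induction v rule: dom_approx.induct)
  case (1 v)
  show ?case
  proof (cases "dominant v")
    case True
    then have "dom_approx v = v" by (simp add: dom_approx.simps)
    then show ?thesis using True 1(2) by (auto intro!: exI[of _ "[]"])
  next
    case False
    define i where "i = last_ascent v"
    obtain n where n: "v permutes {1..n}" using 1(2) by (auto simp: S_infty_def)
    note i = last_ascent_props[OF n False, folded i_def]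
    have eq: "dom_approx v = dom_approx (v \<circ> adj i)"
      using False 1(2) by (simp add: dom_approx.simps[of v] i_def)
    have S: "v \<circ> adj i \<in> S_infty" using 1(2) i by simp
    then obtain ds where ds: "dom_approx v \<in> S_infty" "dominant (dom_approx v)"
      "\<forall>i\<in>set ds. 1 \<le> i" "dom_approx v = v \<circ> adj i \<circ> word_prod ds"
      "len (dom_approx v) = len (v \<circ> adj i) + length ds"
      "schubert_xy (v \<circ> adj i) = divdiff_word ds (schubert_xy (dom_approx v))"
      using 1(1) False 1(2) unfolding eq i_def by blast
    have "schubert_xy v = divdiff i (schubert_xy (v \<circ> adj i))"
      using divdiff_schubert_descent[OF S i(1)] i(4) by simp
    then have "schubert_xy v = divdiff_word (i # ds) (schubert_xy (dom_approx v))"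
      using ds(6) by simp
    moreover have "dom_approx v = v \<circ> word_prod (i # ds)" using ds(4) by (simp add: comp_assoc)
    moreover have "len (dom_approx v) = len v + length (i # ds)"
      using ds(5) len_adj[OF 1(2) i(1)] i(4) by simp
    ultimately show ?thesis using ds(1,2,3) i(1) by (metis set_ConsD)
  qed
qed

lemma down_closed_eq_interval:
  fixes A :: "nat set"
  assumes "finite A" "0 \<notin> A" "\<And>i j. j \<in> A \<Longrightarrow> 1 \<le> i \<Longrightarrow> i \<le> j \<Longrightarrow> i \<in> A"
  shows "A = {1..card A}"
proof (cases "A = {}")
  case False
  have "A = {1..Max A}"
  proof (intro equalityI subsetI)
    fix i assume "i \<in> A"
    then show "i \<in> {1..Max A}" using assms(1,2) by (cases "i = 0") auto
  next
    fix i assume "i \<in> {1..Max A}"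
    then show "i \<in> A" using assms(3)[of "Max A" i] Max_in[OF assms(1) False] by simp
  qed
  then show ?thesis by (metis card_atLeastAtMost diff_Suc_1)
qed simp

lemma dominant_antimono:
  assumes "dominant u" "1 \<le> i" "i \<le> j"
  shows "lehmer_code u j \<le> lehmer_code u i"
  using assms(3)
proof (induction j rule: dec_induct)
  case (step j)
  have "lehmer_code u (j + 1) \<le> lehmer_code u j"
    using assms step(1) unfolding dominant_def by simp
  then show ?case using step by simp
qed simp

text \<open>Rearranges the product over the diagram from rows to columns. As the code decreases, the
  rows that reach column \<open>j\<close> form the initial interval of length
  \<open>lambda_part v j\<close>.\<close>

lemma schubert_dominant_columns:
  assumes "dom_approx v \<in> S_infty" "dominant (dom_approx v)"
  shows "schubert_xy (dom_approx v) = (\<Prod>l<length (conj_partition v).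
    \<Prod>i\<in>{1..conj_partition v ! l}. X i - Y (l + 1))"
proof -
  define c where "c = lehmer_code (dom_approx v)"
  obtain n where n: "dom_approx v permutes {1..n + 1}" using S_infty_permutes_above[OF assms(1)] .
  have supp: "c i = 0" if "n + 1 \<le> i" for i
    using permutes_lehmer_code_0[OF n that] by (simp add: c_def)
  have anti: "c j \<le> c i" if "1 \<le> i" "i \<le> j" for i j
    using dominant_antimono[OF assms(2) that] by (simp add: c_def)
  have col: "{i. 1 \<le> i \<and> j \<le> c i} = {1..lambda_part v j}" if "1 \<le> j" for j
  proof -
    have "i \<le> n + 1" if "j \<le> c i" for i
      using supp[of i] that \<open>1 \<le> j\<close> by (cases "n + 1 \<le> i") auto
    then have "{i. 1 \<le> i \<and> j \<le> c i} \<subseteq> {..n + 1}" by blast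
    then have "finite {i. 1 \<le> i \<and> j \<le> c i}" by (rule finite_subset) simp
    then have "{i. 1 \<le> i \<and> j \<le> c i} = {1..card {i. 1 \<le> i \<and> j \<le> c i}}"
      using anti by (intro down_closed_eq_interval) (auto intro: order_trans)
    then show ?thesis by (simp add: lambda_part_def c_def)
  qed
  \<comment> \<open>Row 1 is the longest, so it decides how many columns there are.\<close>
  have nonzero: "lambda_part v j \<noteq> 0 \<longleftrightarrow> j \<le> c 1" if "1 \<le> j" for j
  proof -
    have "lambda_part v j \<noteq> 0 \<longleftrightarrow> 1 \<in> {1..lambda_part v j}" by auto
    then show ?thesis unfolding col[OF that, symmetric] by simp
  qed
  have "{j. 1 \<le> j \<and> lambda_part v j \<noteq> 0} = {1..c 1}" using nonzero by auto
  then have parts: "conj_partition v = map (lambda_part v) [1..<c 1 + 1]"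
    by (simp add: conj_partition_def)
  have len: "length (conj_partition v) = c 1" by (simp add: parts)
  have nth: "conj_partition v ! l = lambda_part v (l + 1)" if "l < c 1" for l
    using that by (simp add: parts del: upt_Suc)
  have mem: "i \<in> {1..lambda_part v j} \<longleftrightarrow> 1 \<le> i \<and> j \<le> c i" if "1 \<le> j" for i j
    unfolding col[OF that, symmetric] by simp
  have "schubert_xy (dom_approx v) = (\<Prod>(i, j)\<in>Sigma {1..n + 1} (\<lambda>i. {1..c i}). X i - Y j)"
    unfolding schubert_dominant[OF n assms(2)] code_poly_def c_def by (rule prod.Sigma) auto
  also have "\<dots> = (\<Prod>(l, i)\<in>Sigma {..<c 1} (\<lambda>l. {1..lambda_part v (l + 1)}). X i - Y (l + 1))"
  proof (rule prod.reindex_bij_witness[of _ "\<lambda>(l, i). (i, l + 1)" "\<lambda>(i, j). (j - 1, i)"])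
    fix p assume "p \<in> Sigma {1..n + 1} (\<lambda>i. {1..c i})"
    then obtain i j where p: "p = (i, j)" "1 \<le> i" "1 \<le> j" "j \<le> c i" by auto
    then show "(case p of (i, j) \<Rightarrow> (j - 1, i)) \<in> Sigma {..<c 1} (\<lambda>l. {1..lambda_part v (l + 1)})"
      using mem[of j i] anti[of 1 i] by auto
  next
    fix p assume "p \<in> Sigma {..<c 1} (\<lambda>l. {1..lambda_part v (l + 1)})"
    then obtain l i where p: "p = (l, i)" "l < c 1" "i \<in> {1..lambda_part v (l + 1)}" by auto
    then have i: "1 \<le> i" "l + 1 \<le> c i" using mem[of "l + 1" i] by auto
    moreover have "i \<le> n + 1" using supp[of i] i by (cases "n + 1 \<le> i") auto
    ultimately show "(case p of (l, i) \<Rightarrow> (i, l + 1)) \<in> Sigma {1..n + 1} (\<lambda>i. {1..c i})"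
      using p(1) by simp
  qed auto
  also have "\<dots> = (\<Prod>l<c 1. \<Prod>i\<in>{1..lambda_part v (l + 1)}. X i - Y (l + 1))"
    by (rule prod.Sigma[symmetric]) auto
  finally show ?thesis using len nth by simp
qed

subsection \<open>Parabolic subgroups\<close>

text \<open>Every adjacent transposition other than \<open>adj i\<close> preserves the positions up
  to \<open>i\<close>.\<close>

lemma word_prod_preserves:
  assumes "i \<notin> set ws" "a \<le> i"
  shows "word_prod ws a \<le> i"
  using assms by (induction ws) (auto simp: adj_def transpose_def)

text \<open>Only \<open>k = i\<close> can move a value out of the first \<open>i\<close> positions,
  and at an ascent it is replaced by a larger one.\<close>

lemma exceeds_adj:
  assumes "w k < w (Suc k)" "1 \<le> k" and a: "1 \<le> a" "a \<le> i" "i < w a"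
  shows "\<exists>a. 1 \<le> a \<and> a \<le> i \<and> i < (w \<circ> adj k) a"
proof (cases "k = i")
  case True
  then show ?thesis
    using assms by (cases "a = i") (auto intro: exI[of _ i] exI[of _ a])
next
  case False
  then have "1 \<le> adj k a \<and> adj k a \<le> i" using assms by (auto simp: adj_def transpose_def)
  then show ?thesis using a by (intro exI[of _ "adj k a"]) simp
qed

text \<open>A value beyond \<open>i\<close> among the first \<open>i\<close> positions is never
  lost, by \<open>exceeds_adj\<close>. If there is none when \<open>i\<close> is appended, the first
  \<open>i\<close> positions are permuted among themselves, and the new letter brings in the value
  at \<open>Suc i\<close>, which exceeds \<open>i\<close>.\<close>

lemma reduced_word_letters:
  assumes "\<forall>i\<in>set ds. 1 \<le> i" "len (word_prod ds) = length ds"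
  shows "i \<in> set ds \<Longrightarrow> \<exists>a. 1 \<le> a \<and> a \<le> i \<and> i < word_prod ds a"
  using assms
proof (induction ds rule: rev_induct)
  case (snoc k ds)
  let ?w = "word_prod ds"
  have k: "1 \<le> k" "\<forall>i\<in>set ds. 1 \<le> i" using snoc.prems by auto
  have w: "?w \<in> S_infty" using word_prod_in_S_infty k by blast
  have eq: "word_prod (ds @ [k]) = ?w \<circ> adj k" by (simp add: word_prod_append)
  have "len (?w \<circ> adj k) = length ds + 1" using snoc.prems(3) by (simp add: word_prod_append comp_def)
  moreover have "len ?w \<le> length ds" using len_word_prod_le k by blast
  moreover have "len (?w \<circ> adj k) \<le> len ?w + 1" using len_adj_bounds(1)[OF w k(1)] .
  ultimately have l: "len ?w = length ds" "len ?w < len (?w \<circ> adj k)" by linarith+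
  then have asc: "?w k < ?w (Suc k)" using len_adj_less_iff[OF w k(1)] by blast
  show ?case
  proof (cases "\<exists>a. 1 \<le> a \<and> a \<le> i \<and> i < ?w a")
    case True
    then show ?thesis unfolding eq using exceeds_adj[OF asc k(1)] by blast
  next
    case False
    then have ki: "k = i" using snoc l k by auto
    have "?w ` {1..i} \<subseteq> {1..i}" using False S_infty_pos[OF w] by (auto simp: not_less)
    moreover have inj: "inj_on ?w {1..i}" using S_infty_inj[OF w] by (simp add: inj_on_def)
    ultimately have onto: "?w ` {1..i} = {1..i}" by (simp add: endo_inj_surj)
    have "?w (Suc i) \<notin> ?w ` {1..i}"
    proof
      assume "?w (Suc i) \<in> ?w ` {1..i}"
      then obtain a where "?w (Suc i) = ?w a" "a \<le> i" by auto
      then show False using S_infty_inj[OF w, of "Suc i" a] by simp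
    qed
    then have "i < ?w (Suc i)" unfolding onto using S_infty_pos[OF w, of "Suc i"] by auto
    then show ?thesis unfolding eq using ki k(1) by (intro exI[of _ i]) simp
  qed
qed simp

text \<open>A letter \<open>i\<close> of the reduced word moves a position up to \<open>i\<close>
  beyond \<open>i\<close>, which is impossible for a word without \<open>i\<close>.\<close>

lemma reduced_word_subset:
  assumes "\<forall>i\<in>set ds. 1 \<le> i" "len (word_prod ds) = length ds" "word_prod ds = word_prod ws"
  shows "set ds \<subseteq> set ws"
proof
  fix i assume "i \<in> set ds"
  then obtain a where "a \<le> i" "i < word_prod ws a"
    using reduced_word_letters[OF assms(1,2)] assms(3) by auto
  then show "i \<in> set ws" using word_prod_preserves[of i ws a] by fastforce
qed

subsection \<open>Applying divided differences\<close>

lemma divdiff_word_mult_left: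
  "(\<And>i. i \<in> set ds \<Longrightarrow> act i c = c) \<Longrightarrow> divdiff_word ds (c * P) = c * divdiff_word ds P"
  by (induction ds) (simp_all add: divdiff_mult_left)

lemma divdiff_word_sum: "divdiff_word ds (sum f A) = (\<Sum>a\<in>A. divdiff_word ds (f a))"
  by (induction ds) (simp_all add: divdiff_sum)

lemma divdiff_word_y_to_z:
  "subst_poly (\<lambda>a. Var (y_to_z_indet a)) (divdiff_word ds P) =
    divdiff_word ds (subst_poly (\<lambda>a. Var (y_to_z_indet a)) P)"
  by (induction ds) (simp_all add: divdiff_y_to_z)

text \<open>The inequality is part of the induction: once a letter fails to lower the length, the
  deficit persists, so the length equation stays false and the result stays zero.\<close>

lemma divdiff_word_schubert:
  assumes w: "w \<in> S_infty" and "\<forall>i\<in>set ds. 1 \<le> i"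
  shows "len w \<le> len (w \<circ> inv (word_prod ds)) + length ds \<and>
    divdiff_word ds (schubert_xy w) =
      (if len w = len (w \<circ> inv (word_prod ds)) + length ds
       then schubert_xy (w \<circ> inv (word_prod ds)) else 0)"
  using assms(2)
proof (induction ds)
  case (Cons i ds)
  define x where "x = w \<circ> inv (word_prod ds)"
  have i: "1 \<le> i" and ds: "\<forall>i\<in>set ds. 1 \<le> i" using Cons.prems by auto
  have x: "x \<in> S_infty" using w word_prod_in_S_infty[OF ds] by (simp add: x_def)
  have eq: "w \<circ> inv (word_prod (i # ds)) = x \<circ> adj i"
    using S_infty_bij[OF word_prod_in_S_infty[OF ds]] by (simp add: x_def o_inv_distrib comp_assoc)
  have IH: "len w \<le> len x + length ds"
    "divdiff_word ds (schubert_xy w) = (if len w = len x + length ds then schubert_xy x else 0)"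
    using Cons.IH[OF ds] unfolding x_def by blast+
  have bound: "len x \<le> len (x \<circ> adj i) + 1" using len_adj_bounds(2)[OF x i] .
  show ?case
  proof (cases "len w = len x + length ds")
    case True
    then have D: "divdiff_word (i # ds) (schubert_xy w) = divdiff i (schubert_xy x)"
      using IH(2) by (simp only: divdiff_word_simps if_True refl)
    show ?thesis
      unfolding eq D
    proof (rule ascent_or_descent[OF x, of i])
      assume a: "x i < x (Suc i)"
      show "len w \<le> len (x \<circ> adj i) + length (i # ds) \<and> divdiff i (schubert_xy x) =
        (if len w = len (x \<circ> adj i) + length (i # ds) then schubert_xy (x \<circ> adj i) else 0)"
        using divdiff_schubert_ascent[OF x i a] len_adj[OF x i a] True
        by simp
    next
      assume a: "x (Suc i) < x i"
      show "len w \<le> len (x \<circ> adj i) + length (i # ds) \<and> divdiff i (schubert_xy x) =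
        (if len w = len (x \<circ> adj i) + length (i # ds) then schubert_xy (x \<circ> adj i) else 0)"
        using divdiff_schubert_descent[OF x i a] len_adj_descent[OF x i a] True
        by simp
    qed
  next
    case False
    then have "divdiff_word (i # ds) (schubert_xy w) = 0"
      using IH(2) by (simp add: divdiff_symmetric)
    moreover have "len w < len x + length ds" using False IH(1) by linarith
    ultimately show ?thesis unfolding eq using bound by (simp add: comp_def)
  qed
qed simp

theorem theorem8p1:
  fixes u v :: "nat \<Rightarrow> nat" and ws :: "nat list"
  assumes "u \<in> S_infty" and "v \<in> S_infty"
    and "\<forall>i\<in>set ws. 1 \<le> i"
    and "inv v \<circ> dom_approx v = word_prod ws"
    and "\<forall>i\<in>set ws. len (u \<circ> adj i) > len u"
  shows "finite {w \<in> S_infty. e_coeff u v w \<noteq> 0} \<and>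
    schubert_xy u * schubert_xz v =
      (\<Sum>w\<in>{w \<in> S_infty. e_coeff u v w \<noteq> 0}. e_coeff u v w * schubert_xy w)"
proof -
  note u = assms(1) and v = assms(2)
  define m where "m = dom_approx v"
  define lam where "lam = conj_partition v"
  obtain ds where m: "m \<in> S_infty" "dominant m"
    and ds: "\<forall>i\<in>set ds. 1 \<le> i" "m = v \<circ> word_prod ds" "len m = len v + length ds"
      "schubert_xy v = divdiff_word ds (schubert_xy m)"
    using dom_approx_props[OF v] unfolding m_def by blast
  define g where "g = word_prod ds"
  have g: "g \<in> S_infty" unfolding g_def using word_prod_in_S_infty ds(1) by blast
  have vm: "inv v \<circ> m = g"
    unfolding ds(2) g_def comp_assoc[symmetric] S_infty_inv_comp(2)[OF v] by simp
  \<comment> \<open>Squeezes \<open>len g\<close> between \<open>len m - len v\<close> and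
    \<open>length ds\<close>, which agree; so \<open>ds\<close> is a reduced word for
    \<open>g\<close>.\<close>
  have len_g: "len g = length ds"
  proof -
    obtain gs where gs: "reduced_word gs g" using exists_reduced_word[OF g] by blast
    then have "len m \<le> len v + len g"
      using len_comp_word_prod_le[OF v, of gs] ds(2) by (simp add: reduced_word_def g_def)
    moreover have "len g \<le> length ds" unfolding g_def using len_word_prod_le ds(1) by blast
    ultimately show ?thesis using ds(3) by linarith
  qed
  have letters: "set ds \<subseteq> set ws"
    using reduced_word_subset[OF ds(1)] len_g vm assms(4) unfolding g_def m_def by simp
  have sym: "act i (schubert_xy u) = schubert_xy u" if "i \<in> set ds" for i
  proof -
    have i: "1 \<le> i" "len u < len (u \<circ> adj i)" using that letters assms(3,5) by auto
    then have "u i < u (Suc i)" using len_adj_less_iff[OF u] by blast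
    then show ?thesis using divdiff_schubert_ascent[OF u i(1)] act_eq_of_divdiff_0 by blast
  qed
  define W where "W = (\<lambda>p. p ! length lam) ` paths_from lam u"
  have finW: "finite W" unfolding W_def using finite_paths_from[OF u] by simp
  have WS: "w \<in> S_infty" if "w \<in> W" for w using that paths_from_in_S_infty[OF _ u] by (auto simp: W_def)
  \<comment> \<open>The endpoints that survive the divided differences. For
    \<open>w \<circ> g\<close> in place of \<open>w\<close> this is the length condition of
    \<open>e_coeff\<close>.\<close>
  define good where "good w \<longleftrightarrow> len w = len (w \<circ> inv g) + length ds" for w
  have e: "e_coeff u v w = (if len (w \<circ> g) = len w + length ds then d_coeff u lam (w \<circ> g) else 0)" for w
    unfolding e_coeff_def m_def[symmetric] lam_def[symmetric] comp_assoc vm len_g ..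
  have gg: "w \<circ> inv g \<circ> g = w" "w \<circ> g \<circ> inv g = w" for w
    by (simp_all add: comp_assoc S_infty_inv_comp[OF g])
  let ?E = "{w \<in> S_infty. e_coeff u v w \<noteq> 0}"
  let ?I = "(\<lambda>w. w \<circ> inv g) ` {w \<in> W. good w}"
  \<comment> \<open>The expansion is first obtained over \<open>?I\<close>; the permutations of
    \<open>?I\<close> outside \<open>?E\<close> have coefficient zero.\<close>
  have sub: "?E \<subseteq> ?I"
  proof
    fix w assume "w \<in> ?E"
    then have "len (w \<circ> g) = len w + length ds" "d_coeff u lam (w \<circ> g) \<noteq> 0"
      using e by (auto split: if_splits)
    then have "w \<circ> g \<in> W" "good (w \<circ> g)"
      using d_coeff_eq_0[OF u, of "w \<circ> g" lam] unfolding W_def good_def gg by auto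
    then have "w \<circ> g \<circ> inv g \<in> ?I" by blast
    then show "w \<in> ?I" unfolding gg .
  qed
  have finI: "finite ?I" using finW by simp
  have "schubert_xz v = divdiff_word ds (\<Prod>l<length lam. \<Prod>i\<in>{1..lam ! l}. X i - Z (l + 1))"
    using schubert_dominant_columns[of v] m
    by (simp add: schubert_xz_def ds(4) divdiff_word_y_to_z m_def lam_def subst_poly_hom)
  \<comment> \<open>By \<open>sym\<close> the polynomial of \<open>u\<close> is a constant for the
    divided differences along \<open>ds\<close> and moves inside.\<close>
  then have "schubert_xy u * schubert_xz v =
      divdiff_word ds (schubert_xy u * (\<Prod>l<length lam. \<Prod>i\<in>{1..lam ! l}. X i - Z (l + 1)))"
    by (simp only: divdiff_word_mult_left[of ds "schubert_xy u", OF sym])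
  also have "\<dots> = (\<Sum>w\<in>W. d_coeff u lam w * divdiff_word ds (schubert_xy w))"
    unfolding mult.commute[of "schubert_xy u"] pieri_d_coeff[OF u] W_def divdiff_word_sum
    by (simp add: divdiff_word_mult_left act_d_coeff)
  also have "\<dots> = (\<Sum>w\<in>{w \<in> W. good w}. d_coeff u lam w * schubert_xy (w \<circ> inv g))"
    using finW divdiff_word_schubert[OF WS ds(1)]
    by (intro sum.mono_neutral_cong_right) (auto simp: good_def g_def)
  also have "\<dots> = (\<Sum>w\<in>?I. e_coeff u v w * schubert_xy w)"
  proof -
    have "inj_on (\<lambda>w. w \<circ> inv g) {w \<in> W. good w}" by (rule inj_onI) (metis gg(1))
    moreover have "e_coeff u v (w \<circ> inv g) = d_coeff u lam w" if "good w" for w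
      using that unfolding e gg good_def by simp
    ultimately show ?thesis by (simp add: sum.reindex)
  qed
  also have "\<dots> = (\<Sum>w\<in>?E. e_coeff u v w * schubert_xy w)"
  proof (rule sum.mono_neutral_right[OF finI sub])
    have "w \<circ> inv g \<in> S_infty" if "w \<in> W" for w using WS[OF that] g by simp
    then show "\<forall>w\<in>?I - ?E. e_coeff u v w * schubert_xy w = 0" by auto
  qed
  finally show ?thesis using finite_subset[OF sub finI] by blast
qed

end
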